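(* Let $p$ be an odd prime. Then $$\sum_{n=0}^{p-1}\frac{20n+3}{(-2^{10})^n}\binom{4n}{n,n,n,n}\equiv 3p(-1)^{(p-1)/2}+3p^3E_{p-3}\pmod{p^4}.$$
   Context: $\binom{4n}{n,n,n,n}=\frac{(4n)!}{(n!)^4}$ is the multinomial coefficient. $E_n$ denotes the $n$-th Euler number, defined by $E_0=1$ and $E_n=-\sum_{k=1}^{\lfloor n/2\rfloor}\binom{n}{2k}E_{n-2k}$ for $n\ge1$. For rationals $a,b$ and an integer $m\ge1$, $a\equiv b\pmod{p^m}$ means that $a-b=p^m c$ for some rational $c$ whose denominator is not divisible by $p$. *)

theory Defs
  imports "HOL-Number_Theory.Number_Theory"
begin

function euler_num :: "nat \<Rightarrow> int" where
  "euler_num n = (if n = 0 then 1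
     else - (\<Sum>k\<in>{1..n div 2}. int (n choose (2*k)) * euler_num (n - 2*k)))"
  by auto
termination
  by (relation "measure id") auto

definition rat_cong_pow :: "rat \<Rightarrow> rat \<Rightarrow> nat \<Rightarrow> nat \<Rightarrow> bool" where
  "rat_cong_pow a b p k \<longleftrightarrow>
     (\<exists>c::rat. a - b = of_nat (p ^ k) * c \<and> \<not> (int p dvd snd (quotient_of c)))"

end

theory Submission
  imports Defs
begin

text \<open>
  Let \<open>m = (p-1)/2\<close> and assume \<open>p \<ge> 5\<close>. With the WZ pair
  \<open>F(n,k) = (-1)^(n+k) (20n-2k+3) (1/2)_n (1/2)_{2n+k} / ((n-k)! n!^2 (1/2)_k^2 16^n)\<close> the summand is
  \<open>F(n,0)\<close>, so the sum equals \<open>\<Sum>_{n<p} F(n,m) + \<Sum>_{k=1}^{m} G(p,k)\<close>.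

  The only term \<open>F(n,m)\<close> of p-adic valuation 1 is \<open>F(m,m)\<close>; it is \<open>3p(-1)^m\<close> modulo \<open>p^4\<close> by
  Morley's congruence, which comes from pairing the factors i and p - i. The terms \<open>F(m+N,m)\<close> are
  divisible by \<open>p^3\<close>, and modulo \<open>p^4\<close> they are proportional to those of a second terminating WZ
  sum whose value is a multiple of the harmonic number \<open>H_p\<close>; by Wolstenholme's congruence they cancel.

  The \<open>G(p,k)\<close> are also divisible by \<open>p^3\<close>, and modulo \<open>p^4\<close> their sum becomes
  \<open>\<Sum> (-1)^k / (k^2 (m choose k))\<close>, which telescopes in m to \<open>\<Sum>_{j\<le>m} (1 + 2(-1)^j)/j^2\<close>. Its first
  part vanishes modulo p, and the alternating part is an alternating power sum of exponent \<open>p - 3\<close> by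
  Fermat, hence a value of an Euler polynomial.
\<close>

subsection \<open>Congruences between rationals with denominators prime to p\<close>

locale odd_prime =
  fixes p :: nat
  assumes p_prime: "prime p" and p_ge: "3 \<le> p"
begin

text \<open>The integers localized at p, as a subring of the rationals. Fractions need not be in
  lowest terms, so the closure proofs need no gcd arguments; \<open>rat_cong_pow_if_zcong\<close>
  deals with reduced denominators once.\<close>

definition zp :: "rat set" where
  "zp = {x. \<exists>a b::int. \<not> int p dvd b \<and> x = of_int a / of_int b}"

definition zp_unit :: "rat set" where
  "zp_unit = {x. \<exists>a b::int. \<not> int p dvd a \<and> \<not> int p dvd b \<and> x = of_int a / of_int b}"

definition zcong :: "nat \<Rightarrow> rat \<Rightarrow> rat \<Rightarrow> bool" where
  "zcong k x y \<longleftrightarrow> (\<exists>c\<in>zp. x - y = of_nat p ^ k * c)"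

lemma not_dvd_mult: "\<not> int p dvd a \<Longrightarrow> \<not> int p dvd b \<Longrightarrow> \<not> int p dvd a * b"
  using p_prime by (metis prime_dvd_mult_iff prime_nat_int_transfer)

lemma zp_of_int [simp]: "of_int a \<in> zp"
  unfolding zp_def using p_ge by (intro CollectI exI[of _ a] exI[of _ 1]) auto

lemma zp_of_nat [simp]: "of_nat a \<in> zp"
  using zp_of_int[of "int a"] by simp

lemma zp_fact [simp]: "fact n \<in> zp"
  using zp_of_nat[of "fact n"] by simp

lemma zp_numeral [simp]: "numeral a \<in> zp" "1 \<in> zp" "0 \<in> zp"
  using zp_of_nat[of "numeral a"] zp_of_nat[of 1] zp_of_nat[of 0] by simp_all

lemma zp_add [simp]: "x \<in> zp \<Longrightarrow> y \<in> zp \<Longrightarrow> x + y \<in> zp"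
proof -
  assume "x \<in> zp" "y \<in> zp"
  then obtain a b c d :: int where h: "\<not> int p dvd b" "x = of_int a / of_int b"
      "\<not> int p dvd d" "y = of_int c / of_int d"
    unfolding zp_def by blast
  then have "b \<noteq> 0" "d \<noteq> 0" by auto
  then have "x + y = of_int (a * d + c * b) / of_int (b * d)"
    using h by (simp add: field_simps)
  then show ?thesis unfolding zp_def using not_dvd_mult[OF h(1,3)] by blast
qed

lemma zp_mult [simp]: "x \<in> zp \<Longrightarrow> y \<in> zp \<Longrightarrow> x * y \<in> zp"
proof -
  assume "x \<in> zp" "y \<in> zp"
  then obtain a b c d :: int where h: "\<not> int p dvd b" "x = of_int a / of_int b"
      "\<not> int p dvd d" "y = of_int c / of_int d"
    unfolding zp_def by blast
  then have "x * y = of_int (a * c) / of_int (b * d)" by simp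
  then show ?thesis unfolding zp_def using not_dvd_mult[OF h(1,3)] by blast
qed

lemma zp_uminus [simp]: "x \<in> zp \<Longrightarrow> - x \<in> zp"
  using zp_mult[OF zp_of_int[of "-1"]] by simp

lemma zp_diff [simp]: "x \<in> zp \<Longrightarrow> y \<in> zp \<Longrightarrow> x - y \<in> zp"
  using zp_add[of x "- y"] by simp

lemma zp_power [simp]: "x \<in> zp \<Longrightarrow> x ^ n \<in> zp"
  by (induction n) auto

lemma zp_prod [simp]: "(\<And>i. i \<in> A \<Longrightarrow> f i \<in> zp) \<Longrightarrow> prod f A \<in> zp"
  by (induction A rule: infinite_finite_induct) auto

lemma zp_sum [simp]: "(\<And>i. i \<in> A \<Longrightarrow> f i \<in> zp) \<Longrightarrow> sum f A \<in> zp"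
  by (induction A rule: infinite_finite_induct) auto

lemma zp_pochhammer [simp]: "x \<in> zp \<Longrightarrow> pochhammer x n \<in> zp"
  unfolding pochhammer_prod by (intro zp_prod) simp

lemma zp_unit_zp [simp]: "x \<in> zp_unit \<Longrightarrow> x \<in> zp"
  unfolding zp_def zp_unit_def by blast

lemma zp_unit_nonzero: "x \<in> zp_unit \<Longrightarrow> x \<noteq> 0"
  unfolding zp_unit_def by auto

lemma zp_unit_mult [simp]: "x \<in> zp_unit \<Longrightarrow> y \<in> zp_unit \<Longrightarrow> x * y \<in> zp_unit"
proof -
  assume "x \<in> zp_unit" "y \<in> zp_unit"
  then obtain a b c d :: int where h: "\<not> int p dvd b" "x = of_int a / of_int b"
      "\<not> int p dvd d" "y = of_int c / of_int d" "\<not> int p dvd a" "\<not> int p dvd c"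
    unfolding zp_unit_def by blast
  then have "x * y = of_int (a * c) / of_int (b * d)" by simp
  then show ?thesis unfolding zp_unit_def using not_dvd_mult[OF h(1,3)] not_dvd_mult[OF h(5,6)] by blast
qed

lemma zp_unit_inverse [simp]: "x \<in> zp_unit \<Longrightarrow> inverse x \<in> zp_unit"
proof -
  assume "x \<in> zp_unit"
  then obtain a b :: int where h: "\<not> int p dvd b" "x = of_int a / of_int b" "\<not> int p dvd a"
    unfolding zp_unit_def by blast
  then have "inverse x = of_int b / of_int a" by simp
  then show ?thesis unfolding zp_unit_def using h by blast
qed

lemma zp_unit_divide [simp]: "x \<in> zp_unit \<Longrightarrow> y \<in> zp_unit \<Longrightarrow> x / y \<in> zp_unit"
  by (simp add: divide_inverse)

lemma zp_divide [simp]: "x \<in> zp \<Longrightarrow> y \<in> zp_unit \<Longrightarrow> x / y \<in> zp"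
  by (simp add: divide_inverse)

lemma zp_unit_of_int: "\<not> int p dvd a \<Longrightarrow> of_int a \<in> zp_unit"
  unfolding zp_unit_def using p_ge by (intro CollectI exI[of _ a] exI[of _ 1]) auto

lemma zp_unit_uminus [simp]: "x \<in> zp_unit \<Longrightarrow> - x \<in> zp_unit"
  using zp_unit_mult[OF zp_unit_of_int[of "-1"]] p_ge by simp

lemma zp_unit_of_nat: "\<not> p dvd a \<Longrightarrow> of_nat a \<in> zp_unit"
  using zp_unit_of_int[of "int a"] by simp

lemma zp_unit_of_nat_less [simp]: "0 < a \<Longrightarrow> a < p \<Longrightarrow> of_nat a \<in> zp_unit"
  by (intro zp_unit_of_nat) (auto dest: dvd_imp_le)

lemma zp_unit_1 [simp]: "1 \<in> zp_unit"
  using zp_unit_of_nat_less[of 1] p_ge by simp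

lemma zp_unit_2 [simp]: "2 \<in> zp_unit"
  using zp_unit_of_nat_less[of 2] p_ge by simp

lemma zp_unit_power [simp]: "x \<in> zp_unit \<Longrightarrow> x ^ n \<in> zp_unit"
  by (induction n) auto

lemma zp_unit_4 [simp]: "4 \<in> zp_unit"
  using zp_unit_power[OF zp_unit_2, of 2] by simp

lemma zp_unit_8 [simp]: "8 \<in> zp_unit"
  using zp_unit_power[OF zp_unit_2, of 3] by simp

lemma zp_unit_16 [simp]: "16 \<in> zp_unit"
  using zp_unit_power[OF zp_unit_2, of 4] by simp

lemma zp_unit_prod [simp]: "(\<And>i. i \<in> A \<Longrightarrow> f i \<in> zp_unit) \<Longrightarrow> prod f A \<in> zp_unit"
  by (induction A rule: infinite_finite_induct) auto

lemma zp_unit_fact [simp]: "n < p \<Longrightarrow> fact n \<in> zp_unit"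
  by (induction n) (auto intro!: zp_unit_mult simp: zp_unit_of_nat_less[of "Suc _", simplified])

section \<open>Congruence modulo powers of p\<close>

lemma zcong_refl [simp]: "zcong k x x"
  unfolding zcong_def by (auto intro!: bexI[of _ 0])

lemma zcong_sym: "zcong k x y \<Longrightarrow> zcong k y x"
proof -
  assume "zcong k x y"
  then obtain c where "c \<in> zp" "x - y = of_nat p ^ k * c" unfolding zcong_def by blast
  then show ?thesis unfolding zcong_def by (intro bexI[of _ "- c"]) (auto simp: algebra_simps)
qed

lemma zcong_trans [trans]: "zcong k x y \<Longrightarrow> zcong k y z \<Longrightarrow> zcong k x z"
proof -
  assume "zcong k x y" "zcong k y z"
  then obtain c d where "c \<in> zp" "d \<in> zp" "x - y = of_nat p ^ k * c" "y - z = of_nat p ^ k * d"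
    unfolding zcong_def by blast
  then have "c + d \<in> zp" "x - z = of_nat p ^ k * (c + d)" by (auto simp: algebra_simps)
  then show ?thesis unfolding zcong_def by blast
qed

lemma zcong_add: "zcong k x y \<Longrightarrow> zcong k u v \<Longrightarrow> zcong k (x + u) (y + v)"
proof -
  assume "zcong k x y" "zcong k u v"
  then obtain c d where "c \<in> zp" "d \<in> zp" "x - y = of_nat p ^ k * c" "u - v = of_nat p ^ k * d"
    unfolding zcong_def by blast
  then have "c + d \<in> zp" "(x + u) - (y + v) = of_nat p ^ k * (c + d)" by (auto simp: algebra_simps)
  then show ?thesis unfolding zcong_def by blast
qed

lemma zcong_mult_left: "zcong k x y \<Longrightarrow> u \<in> zp \<Longrightarrow> zcong k (u * x) (u * y)"
  unfolding zcong_def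
proof (elim bexE)
  fix c assume "u \<in> zp" "c \<in> zp" "x - y = of_nat p ^ k * c"
  then show "\<exists>c\<in>zp. u * x - u * y = of_nat p ^ k * c"
    by (intro bexI[of _ "u * c"]) (auto simp: algebra_simps simp flip: right_diff_distrib)
qed

lemma zcong_minus: "zcong k x y \<Longrightarrow> zcong k (- x) (- y)"
  using zcong_mult_left[of k x y "-1"] by simp

lemma zcong_diff: "zcong k x y \<Longrightarrow> zcong k u v \<Longrightarrow> zcong k (x - u) (y - v)"
  using zcong_add[OF _ zcong_minus, of k x y u v] by simp

lemma zcong_zp: "zcong k x y \<Longrightarrow> x \<in> zp \<longleftrightarrow> y \<in> zp"
proof -
  assume "zcong k x y"
  then obtain c where c: "c \<in> zp" "x - y = of_nat p ^ k * c" unfolding zcong_def by blast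
  have "x = y + of_nat p ^ k * c" "y = x - of_nat p ^ k * c" using c(2) by (simp_all add: algebra_simps)
  then show ?thesis using c(1) by (metis zp_add zp_diff zp_mult zp_power zp_of_nat)
qed

lemma zcong_mult: "zcong k x y \<Longrightarrow> zcong k u v \<Longrightarrow> x \<in> zp \<Longrightarrow> u \<in> zp \<Longrightarrow> zcong k (x * u) (y * v)"
  using zcong_mult_left[of k u v x] zcong_mult_left[of k x y v] zcong_zp[of k u v]
  by (auto simp: mult.commute intro: zcong_trans)

text \<open>Subtracting p^(k+1) c turns the numerator into a f - p^(k+1) e b, which is a f modulo p.
  The exponent \<open>Suc k\<close> guarantees at least one factor p.\<close>

lemma zcong_zp_unit_1: "zcong (Suc k) x y \<Longrightarrow> x \<in> zp_unit \<Longrightarrow> y \<in> zp_unit"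
proof -
  assume h: "zcong (Suc k) x y" and "x \<in> zp_unit"
  then obtain a b :: int where ab: "\<not> int p dvd a" "\<not> int p dvd b" "x = of_int a / of_int b"
    unfolding zp_unit_def by blast
  from h obtain c where c: "c \<in> zp" "x - y = of_nat p ^ Suc k * c"
    unfolding zcong_def by blast
  then obtain e f :: int where ef: "\<not> int p dvd f" "c = of_int e / of_int f"
    unfolding zp_def by blast
  have nz: "b \<noteq> 0" "f \<noteq> 0" using ab ef by auto
  have "y = x - of_nat p ^ Suc k * c" using c(2) by simp
  then have "y = of_int (a * f - int p ^ Suc k * e * b) / of_int (b * f)"
    using nz ab(3) ef(2) by (simp add: field_simps)
  moreover have "\<not> int p dvd a * f - int p ^ Suc k * e * b"
  proof
    assume "int p dvd a * f - int p ^ Suc k * e * b"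
    moreover have "int p dvd int p ^ Suc k * e * b" by simp
    ultimately have "int p dvd (a * f - int p ^ Suc k * e * b) + int p ^ Suc k * e * b"
      by (rule dvd_add)
    then have "int p dvd a * f" by simp
    then show False using not_dvd_mult ab(1) ef(1) by blast
  qed
  ultimately show ?thesis unfolding zp_unit_def using not_dvd_mult[OF ab(2) ef(1)] by blast
qed

lemma zcong_zp_unit: "zcong k x y \<Longrightarrow> 0 < k \<Longrightarrow> x \<in> zp_unit \<longleftrightarrow> y \<in> zp_unit"
  using zcong_zp_unit_1[of "k - 1" x y] zcong_zp_unit_1[of "k - 1" y x] zcong_sym[of k x y] by auto

lemma zcong_inverse: "zcong k x y \<Longrightarrow> x \<in> zp_unit \<Longrightarrow> y \<in> zp_unit \<Longrightarrow> zcong k (inverse x) (inverse y)"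
proof -
  assume h: "zcong k x y" "x \<in> zp_unit" "y \<in> zp_unit"
  then have nz: "x \<noteq> 0" "y \<noteq> 0" using zp_unit_nonzero by auto
  have "zcong k ((inverse x * inverse y) * y) ((inverse x * inverse y) * x)"
    by (intro zcong_mult_left zcong_sym[OF h(1)]) (use h in simp)
  then show ?thesis using nz by (simp add: field_simps)
qed

lemma zcong_divide: "zcong k x y \<Longrightarrow> zcong k u v \<Longrightarrow> x \<in> zp \<Longrightarrow> u \<in> zp_unit \<Longrightarrow> v \<in> zp_unit
    \<Longrightarrow> zcong k (x / u) (y / v)"
  unfolding divide_inverse by (intro zcong_mult zcong_inverse) auto

lemma zcong_power: "zcong k x y \<Longrightarrow> x \<in> zp \<Longrightarrow> zcong k (x ^ n) (y ^ n)"
  by (induction n) (auto intro!: zcong_mult)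

lemma zcong_prod: "(\<And>i. i \<in> A \<Longrightarrow> zcong k (f i) (g i)) \<Longrightarrow> (\<And>i. i \<in> A \<Longrightarrow> f i \<in> zp)
    \<Longrightarrow> zcong k (prod f A) (prod g A)"
  by (induction A rule: infinite_finite_induct) (auto intro!: zcong_mult)

lemma zcong_sum: "(\<And>i. i \<in> A \<Longrightarrow> zcong k (f i) (g i)) \<Longrightarrow> zcong k (sum f A) (sum g A)"
  by (induction A rule: infinite_finite_induct) (auto intro!: zcong_add)

lemma zcong_pochhammer: "zcong k x y \<Longrightarrow> x \<in> zp \<Longrightarrow> zcong k (pochhammer x n) (pochhammer y n)"
  unfolding pochhammer_prod by (intro zcong_prod zcong_add) auto

text \<open>Once the powers of p in a term are split off, this reduces the congruences modulo p^4
  below to congruences of the cofactors modulo p^3 or p.\<close>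

lemma zcong_scale: "zcong (k + j) (of_nat p ^ j * x) (of_nat p ^ j * y) \<longleftrightarrow> zcong k x y"
proof -
  have "of_nat p ^ j \<noteq> (0::rat)" using p_ge by simp
  moreover have "of_nat p ^ j * x - of_nat p ^ j * y = of_nat p ^ (k + j) * c
      \<longleftrightarrow> of_nat p ^ j * (x - y) = of_nat p ^ j * (of_nat p ^ k * c)" for c
    by (simp only: power_add left_diff_distrib mult_ac)
  ultimately show ?thesis unfolding zcong_def using p_ge by auto
qed

text \<open>The reduced denominator v divides any other denominator b of the same fraction, since u
  b = a v with u and v coprime; so p does not divide v.\<close>

lemma rat_cong_pow_if_zcong: "zcong k x y \<Longrightarrow> rat_cong_pow x y p k"
proof -
  assume "zcong k x y"
  then obtain a b :: int where ab: "\<not> int p dvd b" "x - y = of_nat p ^ k * (of_int a / of_int b)"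
    unfolding zcong_def zp_def by blast
  define c :: rat where "c = of_int a / of_int b"
  obtain u v where uv: "quotient_of c = (u, v)" by force
  have v: "v > 0" "coprime u v" "c = of_int u / of_int v"
    using quotient_of_denom_pos[OF uv] quotient_of_coprime[OF uv] quotient_of_div[OF uv] by auto
  have "b \<noteq> 0" using ab by auto
  then have "(of_int (u * b) :: rat) = of_int (a * v)"
    using v by (simp add: c_def field_simps)
  then have "u * b = a * v" by (simp only: of_int_eq_iff)
  then have "v dvd u * b" by simp
  then have "v dvd b" using v(2) by (metis coprime_commute coprime_dvd_mult_right_iff)
  then have "\<not> int p dvd v" using ab(1) dvd_trans by blast
  then show ?thesis unfolding rat_cong_pow_def
    by (intro exI[of _ c]) (use ab uv in \<open>simp add: c_def\<close>)
qed

lemma zcong_shift: "c \<in> zp \<Longrightarrow> zcong 1 (of_nat p * c + x) x"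
  unfolding zcong_def by auto

lemma zcong_cancel:
  assumes "zcong k (x * u) (y * u)" "u \<in> zp_unit"
  shows "zcong k x y"
  using zcong_mult_left[OF assms(1), of "inverse u"] assms(2) zp_unit_nonzero[OF assms(2)]
  by (simp add: field_simps)

lemma zcong_of_int:
  assumes "[a = b] (mod int p)"
  shows "zcong 1 (of_int a) (of_int b)"
proof -
  obtain c where "a - b = int p * c" using assms by (metis cong_iff_dvd_diff dvdE)
  then have "of_int a - of_int b = (of_nat p :: rat) ^ 1 * of_int c"
    by (simp flip: of_int_diff)
  then show ?thesis unfolding zcong_def by (intro bexI[of _ "of_int c"]) auto
qed

lemma zcong_wilson: "zcong 1 (fact (p - 1)) (-1)"
  using zcong_of_int[OF wilson_theorem[OF p_prime]] by simp

lemma zcong_fermat: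
  assumes "\<not> p dvd a"
  shows "zcong 1 (of_nat a ^ (p - 1)) 1"
proof -
  have "[int (a ^ (p - 1)) = int 1] (mod int p)"
    using fermat_theorem[OF p_prime assms] by (simp only: cong_int_iff)
  from zcong_of_int[OF this] show ?thesis by simp
qed

end

subsection \<open>WZ pairs\<close>

text \<open>The difference is taken in the rationals, and for n < k both sides are 0. The WZ
  identities can therefore be checked by one computation for all n and k.\<close>

lemma of_nat_choose_Suc:
  "(of_nat (n choose Suc k) :: rat) = of_nat (n choose k) * (of_nat n - of_nat k) / of_nat (Suc k)"
proof (cases "k \<le> n")
  case True
  have "Suc k * (n choose Suc k) = (n choose k) * (n - k)"
    by (metis binomial_absorb_comp binomial_absorption mult.commute)
  then have "of_nat (Suc k) * (of_nat (n choose Suc k) :: rat) = of_nat (n choose k) * of_nat (n - k)"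
    by (metis of_nat_mult)
  then show ?thesis using True by (simp add: field_simps of_nat_diff del: of_nat_Suc)
qed (simp add: binomial_eq_0)

lemma of_nat_Suc_choose_Suc:
  "(of_nat (Suc n choose Suc k) :: rat) = of_nat (n choose k) * of_nat (Suc n) / of_nat (Suc k)"
proof -
  have "of_nat (Suc k) * (of_nat (Suc n choose Suc k) :: rat) = of_nat (Suc n) * of_nat (n choose k)"
    by (metis Suc_times_binomial_eq mult.commute of_nat_mult)
  then show ?thesis by (simp add: field_simps del: of_nat_Suc)
qed

text \<open>The pair satisfies \<open>F(n,k) - F(n,k+1) = G(n+1,k+1) - G(n,k+1)\<close>. The binomial coefficient times
  \<open>k!\<close> stands for \<open>n!/(n-k)!\<close>, so that \<open>wzF n k\<close> vanishes for \<open>n < k\<close>;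
  \<open>wzG n k\<close> is \<open>G(n,k+1)\<close>.\<close>

definition wzF :: "nat \<Rightarrow> nat \<Rightarrow> rat" where
  "wzF n k = (-1) ^ (n + k) * (20 * of_nat n - 2 * of_nat k + 3) * pochhammer (1/2) n
     * pochhammer (1/2) (2 * n + k) * of_nat (n choose k) * fact k
     / (fact n ^ 3 * pochhammer (1/2) k ^ 2 * 16 ^ n)"

definition wzG :: "nat \<Rightarrow> nat \<Rightarrow> rat" where
  "wzG n k = 32 * of_nat n ^ 2 * (-1) ^ (n + Suc k) * pochhammer (1/2) n
     * pochhammer (1/2) (2 * n + k) * of_nat (n choose Suc k) * fact (Suc k)
     / (fact n ^ 3 * pochhammer (1/2) (Suc k) ^ 2 * 16 ^ n)"

lemma pochhammer_half_pos [simp]: "pochhammer (1/2 :: rat) k > 0"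
  by (simp add: pochhammer_pos)

lemma half_plus_nonzero: "(1/2 :: rat) + of_nat k \<noteq> 0"
  by (metis add_pos_nonneg half_gt_zero_iff of_nat_0_le_iff order_less_irrefl zero_less_one)

lemma wz_pair: "wzF n k - wzF n (Suc k) = wzG (Suc n) k - wzG n k"
proof -
  define a b :: rat where "a = of_nat n" and "b = of_nat k"
  define s :: rat where "s = 1/2 + b"
  \<comment> \<open>\<open>c\<close> is F(n,k) without its linear factor. All four terms become
    \<open>c\<close> times rational functions of a and b whose only denominator is
    \<open>s ^ 2\<close>; clearing it leaves a polynomial identity.\<close>
  define c :: rat where "c = (-1) ^ (n + k) * pochhammer (1/2) n * pochhammer (1/2) (2 * n + k)
     * of_nat (n choose k) * fact k / (fact n ^ 3 * pochhammer (1/2) k ^ 2 * 16 ^ n)"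
  have pos: "a \<ge> 0" "b \<ge> 0" by (auto simp: a_def b_def)
  have s0: "s \<noteq> 0" using half_plus_nonzero[of k] by (simp add: s_def b_def)
  have p0: "pochhammer (1/2 :: rat) k \<noteq> 0" using pochhammer_half_pos[of k] by linarith
  have f0: "(fact n :: rat) \<noteq> 0" "b + 1 \<noteq> 0" "a + 1 \<noteq> 0" using pos by auto
  have poch: "pochhammer (1/2) (2 * n + Suc k) = pochhammer (1/2) (2 * n + k) * (2 * a + s)"
    "pochhammer (1/2) (2 * Suc n + k) = pochhammer (1/2) (2 * n + k) * (2 * a + s) * (2 * a + s + 1)"
    "pochhammer (1/2) (Suc k) = pochhammer (1/2) k * s"
    "pochhammer (1/2) (Suc n) = pochhammer (1/2) n * (1/2 + a)"
    by (simp_all add: pochhammer_rec' a_def b_def s_def algebra_simps)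
  have ch: "of_nat (n choose Suc k) * fact (Suc k) = of_nat (n choose k) * fact k * (a - b)"
    "of_nat (Suc n choose Suc k) * fact (Suc k) = of_nat (n choose k) * fact k * (a + 1)"
    using of_nat_choose_Suc[of n k] of_nat_Suc_choose_Suc[of n k] unfolding a_def b_def fact_Suc
    by (simp_all del: of_nat_Suc binomial_Suc_Suc)
  have 1: "wzF n k = c * (20 * a - 2 * b + 3)"
    unfolding wzF_def c_def a_def b_def by simp
  have "wzF n (Suc k) = (-1) ^ (n + Suc k) * (20 * a - 2 * (b + 1) + 3) * pochhammer (1/2) n
     * (pochhammer (1/2) (2 * n + k) * (2 * a + s)) * (of_nat (n choose Suc k) * fact (Suc k))
     / (fact n ^ 3 * (pochhammer (1/2) k * s) ^ 2 * 16 ^ n)"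
    unfolding wzF_def poch a_def b_def by (simp add: mult_ac add_ac)
  also have "\<dots> = - c * (20 * a - 2 * b + 1) * (2 * a + s) * (a - b) / s ^ 2"
    unfolding ch c_def using p0 s0 f0 by (simp add: field_simps)
  finally have 2: "wzF n (Suc k) = - c * (20 * a - 2 * b + 1) * (2 * a + s) * (a - b) / s ^ 2" .
  have "wzG n k = 32 * a ^ 2 * (-1) ^ (n + Suc k) * pochhammer (1/2) n
     * pochhammer (1/2) (2 * n + k) * (of_nat (n choose Suc k) * fact (Suc k))
     / (fact n ^ 3 * (pochhammer (1/2) k * s) ^ 2 * 16 ^ n)"
    unfolding wzG_def poch a_def by (simp add: mult_ac)
  also have "\<dots> = - c * 32 * a ^ 2 * (a - b) / s ^ 2"
    unfolding ch c_def using p0 s0 f0 by (simp add: field_simps)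
  finally have 3: "wzG n k = - c * 32 * a ^ 2 * (a - b) / s ^ 2" .
  have "wzG (Suc n) k = 32 * (a + 1) ^ 2 * (-1) ^ (n + k) * (pochhammer (1/2) n * (1/2 + a))
     * (pochhammer (1/2) (2 * n + k) * (2 * a + s) * (2 * a + s + 1)) * (of_nat (Suc n choose Suc k) * fact (Suc k))
     / (((a + 1) * fact n) ^ 3 * (pochhammer (1/2) k * s) ^ 2 * (16 * 16 ^ n))"
    unfolding wzG_def poch a_def by (simp add: mult_ac add_ac del: binomial_Suc_Suc)
  also have "\<dots> = (32 * (a + 1) ^ 2 * (a + 1) / ((a + 1) ^ 3 * 16)) * (c * (1/2 + a) * (2 * a + s) * (2 * a + s + 1) / s ^ 2)"
    unfolding ch c_def using p0 s0 f0(1,3) by (simp add: power_mult_distrib mult_ac)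
  also have "32 * (a + 1) ^ 2 * (a + 1) / ((a + 1) ^ 3 * 16) = 2"
  proof -
    have "32 * (a + 1) ^ 2 * (a + 1) = 2 * ((a + 1) ^ 3 * 16)"
      by (simp add: power2_eq_square power3_eq_cube)
    then show ?thesis using f0(3) by (simp only: divide_eq_eq) simp
  qed
  finally have 4: "wzG (Suc n) k = 2 * (c * (1/2 + a) * (2 * a + s) * (2 * a + s + 1) / s ^ 2)" .
  have "(wzF n k - wzF n (Suc k)) * s ^ 2
      = c * ((20 * a - 2 * b + 3) * s ^ 2 + (20 * a - 2 * b + 1) * (2 * a + s) * (a - b))"
    unfolding 1 2 using s0 by (simp add: field_simps)
  also have "\<dots> = c * (2 * (1/2 + a) * (2 * a + s) * (2 * a + s + 1) + 32 * a ^ 2 * (a - b))"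
    unfolding s_def by (simp add: field_simps power2_eq_square)
  also have "\<dots> = (wzG (Suc n) k - wzG n k) * s ^ 2"
    unfolding 3 4 using s0 by (simp add: field_simps)
  finally show ?thesis using s0 by simp
qed

text \<open>Each step in k telescopes over n; the lower end \<open>wzG 0 k\<close> is 0 because of
  the factor n^2.\<close>

lemma wz_sum: "(\<Sum>n<r. wzF n 0) = (\<Sum>n<r. wzF n k) + (\<Sum>i<k. wzG r i)"
proof (induction k)
  case (Suc k)
  have "(\<Sum>n<r. wzF n k) - (\<Sum>n<r. wzF n (Suc k)) = (\<Sum>n<r. wzG (Suc n) k - wzG n k)"
    by (simp add: wz_pair flip: sum_subtractf)
  also have "\<dots> = wzG r k" by (subst sum_lessThan_telescope) (simp add: wzG_def)
  finally show ?case using Suc by simp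
qed simp

text \<open>Modulo p, moving the origin of \<open>wzF\<close> to \<open>n = k = (p-1)/2\<close> shifts both arguments by a half; up to
  constants the result is the following \<open>harmF\<close> at \<open>l = p\<close>, with \<open>n = (p-1)/2 + j + 1\<close>.\<close>

definition harmF :: "nat \<Rightarrow> nat \<Rightarrow> rat" where
  "harmF j l = (-1) ^ Suc j * (20 * of_nat j + 2 * of_nat l + 14) * fact j * fact (Suc j) ^ 2 * fact l
     * of_nat (Suc l choose (2 * j + 2)) / (fact (Suc j + l) * of_nat (Suc l) * fact (2 * j + 2))"

text \<open>The WZ mate of \<open>harmF\<close>. Its boundary value 2/(l+1) at j = 0 is the source
  of the harmonic numbers.\<close>

definition harmG :: "nat \<Rightarrow> nat \<Rightarrow> rat" where
  "harmG j l = (-1) ^ j * 8 * (2 * of_nat j + 1) ^ 2 * fact j * fact (Suc j) ^ 2 * fact l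
     * of_nat (Suc l choose (2 * j + 1)) / (of_nat (2 * j + 2) * fact (Suc j + l) * of_nat (Suc l) * fact (2 * j + 2))"

lemma harm_wz_pair: "harmF j (Suc l) - harmF j l = harmG (Suc j) l - harmG j l"
proof -
  define a b :: rat where "a = of_nat j" and "b = of_nat l"
  have pos: "a \<ge> 0" "b \<ge> 0" by (auto simp: a_def b_def)
  \<comment> \<open>The four terms contain binomial coefficients with lower entries 2j+1, 2j+2 and
    2j+3. Each is obtained from \<open>C\<close> without dividing by a factor that may
    vanish.\<close>
  define C :: rat where "C = of_nat (Suc l choose (2 * j + 1))"
  define c where "c = (-1) ^ Suc j * fact j * fact (Suc j) ^ 2 * fact l * C / (fact (Suc j + l) * fact (2 * j + 2))"
  have C1: "of_nat (Suc l choose (2 * j + 2)) = C * (b - 2 * a) / (2 * a + 2)"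
    using of_nat_choose_Suc[of "Suc l" "2 * j + 1"] by (simp add: C_def a_def b_def add_ac del: binomial_Suc_Suc)
  have C2: "of_nat (Suc (Suc l) choose (2 * j + 2)) = C * (b + 2) / (2 * a + 2)"
    using of_nat_Suc_choose_Suc[of "Suc l" "2 * j + 1"] by (simp add: C_def a_def b_def add_ac del: binomial_Suc_Suc)
  have C3: "of_nat (Suc l choose (2 * Suc j + 1)) = C * (b - 2 * a) / (2 * a + 2) * (b - 2 * a - 1) / (2 * a + 3)"
    using of_nat_choose_Suc[of "Suc l" "2 * j + 2"] unfolding C1
    by (simp add: C_def a_def b_def algebra_simps del: binomial_Suc_Suc)
  define f1 f2 f3 f4 f5 :: rat where "f1 = fact j" "f2 = fact (Suc j)" "f3 = fact l" "f4 = fact (Suc j + l)" "f5 = fact (2 * j + 2)"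
  note f_def = this
  have f0: "f1 \<noteq> 0" "f2 \<noteq> 0" "f3 \<noteq> 0" "f4 \<noteq> 0" "f5 \<noteq> 0" by (auto simp: f_def)
  have g: "fact (Suc (Suc j)) = (a + 2) * f2" "fact (Suc l) = (b + 1) * f3"
     "fact (Suc j + Suc l) = (a + b + 2) * f4" "fact (Suc (Suc j) + l) = (a + b + 2) * f4"
     "f2 = (a + 1) * f1"
     "fact (2 * Suc j + 2) = (2 * a + 4) * ((2 * a + 3) * f5)"
    by (simp_all add: f_def a_def b_def algebra_simps)
  have nz: "a + 1 \<noteq> 0" "b + 1 \<noteq> 0" "b + 2 \<noteq> 0" "a + 2 \<noteq> 0" "2 * a + 3 \<noteq> 0" "a + b + 2 \<noteq> 0" using pos by auto
  have c: "c = (-1) ^ Suc j * f1 * f2 ^ 2 * f3 * C / (f4 * f5)" by (simp add: c_def f_def)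
  have "harmF j l = (-1) ^ Suc j * (20 * a + 2 * b + 14) * f1 * f2 ^ 2 * f3 * (C * (b - 2 * a) / (2 * a + 2)) / (f4 * (b + 1) * f5)"
    unfolding harmF_def C1 by (simp add: f_def a_def b_def add_ac)
  also have "\<dots> = c * ((20 * a + 2 * b + 14) * (b - 2 * a) / ((2 * a + 2) * (b + 1)))"
    unfolding c by (simp add: mult_ac)
  finally have 1: "harmF j l = \<dots>" .
  have "harmF j (Suc l) = (-1) ^ Suc j * (20 * a + 2 * (b + 1) + 14) * f1 * f2 ^ 2 * ((b + 1) * f3) * (C * (b + 2) / (2 * a + 2))
      / (((a + b + 2) * f4) * (b + 2) * f5)"
    unfolding harmF_def C2 g by (simp add: f_def a_def b_def add_ac)
  also have "\<dots> = c * ((20 * a + 2 * b + 16) * (b + 1) / ((2 * a + 2) * (a + b + 2)))"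
    unfolding c using nz by (simp add: mult_ac add_ac)
  finally have 2: "harmF j (Suc l) = \<dots>" .
  have "harmG j l = (-1) ^ j * 8 * (2 * a + 1) ^ 2 * f1 * f2 ^ 2 * f3 * C / ((2 * a + 2) * f4 * (b + 1) * f5)"
    unfolding harmG_def by (simp add: f_def a_def b_def C_def add_ac)
  also have "\<dots> = c * (- 8 * (2 * a + 1) ^ 2 / ((2 * a + 2) * (b + 1)))"
    unfolding c by (simp add: mult_ac)
  finally have 3: "harmG j l = \<dots>" .
  have "harmG (Suc j) l = (-1) ^ Suc j * 8 * (2 * (a + 1) + 1) ^ 2 * f2 * ((a + 2) * f2) ^ 2 * f3
      * (C * (b - 2 * a) / (2 * a + 2) * (b - 2 * a - 1) / (2 * a + 3))
      / ((2 * (a + 1) + 2) * ((a + b + 2) * f4) * (b + 1) * ((2 * a + 4) * ((2 * a + 3) * f5)))"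
    unfolding harmG_def C3 g by (simp add: f_def a_def b_def add_ac)
  also have "\<dots> = c * (8 * (2 * a + 3) ^ 2 * (a + 1) * (a + 2) ^ 2 * (b - 2 * a) * (b - 2 * a - 1)
      / ((2 * a + 2) * (2 * a + 3) * (2 * a + 4) * (a + b + 2) * (b + 1) * ((2 * a + 4) * (2 * a + 3))))"
    unfolding c g by (simp add: power_mult_distrib mult_ac add_ac)
  also have "\<dots> = c * ((b - 2 * a) * (b - 2 * a - 1) / ((a + b + 2) * (b + 1)))"
    using nz by (simp add: divide_simps) (simp add: algebra_simps power2_eq_square)
  finally have 4: "harmG (Suc j) l = \<dots>" .
  have "(20 * a + 2 * b + 16) * (b + 1) / ((2 * a + 2) * (a + b + 2))
      - (20 * a + 2 * b + 14) * (b - 2 * a) / ((2 * a + 2) * (b + 1))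
      = (b - 2 * a) * (b - 2 * a - 1) / ((a + b + 2) * (b + 1)) - (- 8 * (2 * a + 1) ^ 2 / ((2 * a + 2) * (b + 1)))"
    using nz by (simp add: divide_simps) (simp add: algebra_simps power2_eq_square)
  then show ?thesis unfolding 1 2 3 4 right_diff_distrib[symmetric] by (simp only:)
qed

text \<open>The bound on l makes the binomial coefficient in \<open>harmG n l\<close> vanish, so
  only the boundary at j = 0 survives the telescoping and contributes -2/(l+1) for each step in l.
  It is applied with l = p and n = (p+1)/2.\<close>

lemma harmF_sum: "l < 2 * n \<Longrightarrow> (\<Sum>j<n. harmF j l) = - 2 * (\<Sum>i=1..l. 1 / of_nat i)"
proof (induction l)
  case 0
  then show ?case by (simp add: harmF_def)
next
  case (Suc l)
  have "(\<Sum>j<n. harmF j (Suc l)) - (\<Sum>j<n. harmF j l) = (\<Sum>j<n. harmG (Suc j) l - harmG j l)"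
    by (simp add: harm_wz_pair flip: sum_subtractf)
  also have "\<dots> = harmG n l - harmG 0 l" by (rule sum_lessThan_telescope)
  also have "harmG n l = 0" using Suc.prems by (simp add: harmG_def binomial_eq_0 del: binomial_Suc_Suc)
  also have "harmG 0 l = 2 / of_nat (Suc l)"
    by (simp add: harmG_def field_simps add_nonneg_eq_0_iff power2_eq_square)
  finally show ?case using Suc by (simp add: algebra_simps)
qed

section \<open>Alternating sums of reciprocal binomial coefficients\<close>

text \<open>Divided by n!, this is the alternating sum of the reciprocals of (n choose i). It
  telescopes through \<open>h\<close>, because (n+1-i) + (i+1) = n+2.\<close>

lemma alternating_fact_sum:
  "(\<Sum>i\<le>n. (-1) ^ i * fact i * fact (n - i) :: rat) = fact (Suc n) * (1 + (-1) ^ n) / of_nat (n + 2)"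
proof -
  define h :: "nat \<Rightarrow> rat" where "h i = (-1) ^ i * fact i * fact (Suc n - i)" for i
  have "of_nat (n + 2) * ((-1) ^ i * fact i * fact (n - i) :: rat) = h i - h (Suc i)" if "i \<le> n" for i
  proof -
    have "fact (Suc n - i) = (of_nat (Suc n - i) * fact (n - i) :: rat)"
      using that by (simp add: Suc_diff_le)
    then have "fact (Suc n - i) = ((of_nat n + 1 - of_nat i) * fact (n - i) :: rat)"
      using that by (simp add: of_nat_diff)
    then show ?thesis unfolding h_def by (simp only:) (simp add: algebra_simps)
  qed
  then have "of_nat (n + 2) * (\<Sum>i\<le>n. (-1) ^ i * fact i * fact (n - i) :: rat) = (\<Sum>i<Suc n. h i - h (Suc i))"
    unfolding sum_distrib_left by (intro sum.cong) auto
  also have "\<dots> = h 0 - h (Suc n)" by (rule sum_lessThan_telescope')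
  also have "\<dots> = fact (Suc n) * (1 + (-1) ^ n)" by (simp add: h_def algebra_simps)
  finally show ?thesis by (simp add: field_simps add_nonneg_eq_0_iff)
qed

text \<open>With k = i + 1 the left side is \<Sum> (-1)^k / (k^2 (n choose k)). Its increment in n
  is found by comparing the terms one by one.\<close>

lemma inverse_binomial_sum:
  "(\<Sum>i<n. (-1) ^ Suc i * fact i * fact (n - Suc i) / (of_nat (Suc i) * fact n) :: rat)
    = (\<Sum>j=1..n. (1 + 2 * (-1) ^ j) / of_nat j ^ 2)"
proof (induction n)
  case (Suc n)
  define t :: "nat \<Rightarrow> nat \<Rightarrow> rat" where "t n i = (-1) ^ Suc i * fact i * fact (n - Suc i) / (of_nat (Suc i) * fact n)" for n i
  \<comment> \<open>The bracket (n - i) - (n + 1) = -(i + 1) cancels the denominator i + 1, which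
    leaves the sum evaluated by \<open>alternating_fact_sum\<close>.\<close>
  have "t (Suc n) i - t n i = (-1) ^ i * fact i * fact (n - 1 - i) / fact (Suc n)" if "i < n" for i
  proof -
    have "n - i = Suc (n - Suc i)" using that by simp
    then have "fact (n - i) = (of_nat (n - i) * fact (n - Suc i) :: rat)" by simp
    then have e: "fact (n - i) = ((of_nat n - of_nat i) * fact (n - Suc i) :: rat)"
      using that by (simp add: of_nat_diff)
    have nz: "(1 + of_nat i :: rat) \<noteq> 0" "(1 + of_nat n :: rat) \<noteq> 0"
      by (simp_all add: add_nonneg_eq_0_iff)
    show ?thesis unfolding t_def using nz by (simp add: e divide_simps) (simp add: algebra_simps)
  qed
  then have "(\<Sum>i<n. t (Suc n) i) - (\<Sum>i<n. t n i) = (\<Sum>i<n. (-1) ^ i * fact i * fact (n - 1 - i)) / fact (Suc n)"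
    by (simp add: sum_divide_distrib flip: sum_subtractf)
  also have "\<dots> = (1 - (-1) ^ n) / of_nat (Suc n) ^ 2"
  proof (cases n)
    case (Suc r)
    have "(\<Sum>i<n. (-1) ^ i * fact i * fact (n - 1 - i) :: rat) = fact n * (1 + (-1) ^ r) / of_nat (Suc n)"
      unfolding Suc lessThan_Suc_atMost using alternating_fact_sum[of r] by simp
    moreover have "(fact (Suc n) :: rat) = of_nat (Suc n) * fact n" by simp
    ultimately show ?thesis using Suc by (simp add: power2_eq_square del: of_nat_Suc fact_Suc)
  qed simp
  finally have "(\<Sum>i<Suc n. t (Suc n) i) = (\<Sum>i<n. t n i) + (1 - (-1) ^ n) / of_nat (Suc n) ^ 2 + t (Suc n) n"
    by simp
  also have "t (Suc n) n = - ((-1) ^ n / of_nat (Suc n) ^ 2)"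
    unfolding t_def fact_Suc by (simp add: power2_eq_square del: of_nat_Suc)
  finally show ?case using Suc unfolding t_def
    by (simp add: diff_divide_distrib add_divide_distrib)
qed simp

subsection \<open>Euler polynomials\<close>

declare euler_num.simps [simp del]

text \<open>The recursion preserves the parity of the index, so from an odd index it never reaches
  \<open>euler_num 0\<close>.\<close>

lemma euler_num_odd: "odd n \<Longrightarrow> euler_num n = 0"
proof (induction n rule: less_induct)
  case (less n)
  have n: "n \<noteq> 0" using odd_pos[OF less.prems] by simp
  have "euler_num (n - 2 * k) = 0" if "k \<in> {1..n div 2}" for k
    using that less.prems n by (intro less.IH) auto
  with n show ?case by (subst euler_num.simps) simp
qed

text \<open>The argument is scaled so that the coefficients are integers: \<open>euler_poly n y\<close> is \<open>2^n\<close> times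
  the classical Euler polynomial at \<open>(y + 1)/2\<close>.\<close>

definition euler_poly :: "nat \<Rightarrow> int \<Rightarrow> int" where
  "euler_poly n y = (\<Sum>k\<le>n. int (n choose k) * euler_num k * y ^ (n - k))"

text \<open>Umbrally (E + 1)^n + (E - 1)^n = 0, which is the defining recursion: with j = n - k only
  even j survive, and they give twice the recursion with all its terms on one side.\<close>

lemma euler_poly_1: "n > 0 \<Longrightarrow> euler_poly n 1 + euler_poly n (-1) = 0"
proof -
  assume n: "n > 0"
  have "euler_poly n 1 + euler_poly n (-1) = (\<Sum>k\<le>n. int (n choose k) * euler_num k * (1 + (-1) ^ (n - k)))"
    unfolding euler_poly_def by (simp add: algebra_simps sum.distrib)
  also have "\<dots> = (\<Sum>j\<le>n. int (n choose (n - j)) * euler_num (n - j) * (1 + (-1) ^ j))"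
    by (rule sum.reindex_bij_witness[where i = "\<lambda>j. n - j" and j = "\<lambda>j. n - j"]) auto
  also have "\<dots> = (\<Sum>j\<in>(\<lambda>k. 2 * k) ` {..n div 2}. int (n choose (n - j)) * euler_num (n - j) * (1 + (-1) ^ j))"
  proof (rule sum.mono_neutral_right)
    show "(*) 2 ` {..n div 2} \<subseteq> {..n}" by auto
    show "\<forall>i\<in>{..n} - (*) 2 ` {..n div 2}. int (n choose (n - i)) * euler_num (n - i) * (1 + (-1) ^ i) = 0"
    proof
      fix i assume i: "i \<in> {..n} - (*) 2 ` {..n div 2}"
      have "odd i"
      proof
        assume "even i"
        then have "i = 2 * (i div 2)" by simp
        then have "i \<in> (*) 2 ` {..n div 2}" using i by (intro image_eqI[of _ _ "i div 2"]) auto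
        then show False using i by simp
      qed
      then show "int (n choose (n - i)) * euler_num (n - i) * (1 + (-1) ^ i) = 0" by simp
    qed
  qed simp
  also have "\<dots> = (\<Sum>k\<le>n div 2. 2 * (int (n choose (2 * k)) * euler_num (n - 2 * k)))"
    by (subst sum.reindex) (auto simp: inj_on_def binomial_symmetric[symmetric] intro!: sum.cong)
  also have "\<dots> = 2 * (\<Sum>k\<le>n div 2. int (n choose (2 * k)) * euler_num (n - 2 * k))"
    by (simp add: sum_distrib_left)
  also have "(\<Sum>k\<le>n div 2. int (n choose (2 * k)) * euler_num (n - 2 * k))
     = euler_num n + (\<Sum>k\<in>{1..n div 2}. int (n choose (2 * k)) * euler_num (n - 2 * k))"
    by (simp add: sum.atLeast_Suc_atMost atMost_atLeast0)
  also have "\<dots> = 0" using n by (subst euler_num.simps) simp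
  finally show ?thesis by simp
qed

lemma euler_poly_0: "euler_poly 0 y = 1"
  by (simp add: euler_poly_def euler_num.simps)

text \<open>The Appell property: expand (y + z)^(n-k) and exchange the two summations over k + j
  \<le> n.\<close>

lemma euler_poly_add: "euler_poly n (y + z) = (\<Sum>j\<le>n. int (n choose j) * y ^ j * euler_poly (n - j) z)"
proof -
  have "euler_poly n (y + z) = (\<Sum>k\<le>n. \<Sum>j\<le>n - k. int (n choose k) * euler_num k * (int (n - k choose j) * y ^ j * z ^ (n - k - j)))"
    unfolding euler_poly_def binomial_ring by (simp add: sum_distrib_left)
  also have "\<dots> = (\<Sum>(k, j)\<in>{(k, j). k + j \<le> n}. int (n choose k) * euler_num k * (int (n - k choose j) * y ^ j * z ^ (n - k - j)))"
    unfolding sum.Sigma[OF finite_atMost ballI, OF finite_atMost] by (rule sum.cong) auto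
  also have "\<dots> = (\<Sum>(j, k)\<in>{(j, k). k + j \<le> n}. int (n choose j) * y ^ j * (int (n - j choose k) * euler_num k * z ^ (n - j - k)))"
  proof (rule sum.reindex_bij_witness[where i = "\<lambda>(j, k). (k, j)" and j = "\<lambda>(k, j). (j, k)"], goal_cases)
    case (5 a)
    then obtain k j where a: "a = (k, j)" "k + j \<le> n" by auto
    \<comment> \<open>Both products equal (n choose k+j) (k+j choose k).\<close>
    then have "(n choose k) * (n - k choose j) = (n choose j) * (n - j choose k)"
      using choose_mult[of k "k + j" n] choose_mult[of j "k + j" n] binomial_symmetric[of k "k + j"]
      by simp
    then have e: "int (n choose j) * int (n - j choose k) = int (n choose k) * int (n - k choose j)"
      by (simp flip: of_nat_mult)
    have "int (n choose j) * y ^ j * (int (n - j choose k) * euler_num k * z ^ (n - j - k))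
        = (int (n choose j) * int (n - j choose k)) * (y ^ j * euler_num k * z ^ (n - k - j))"
      by (simp add: mult_ac add.commute)
    also have "\<dots> = int (n choose k) * euler_num k * (int (n - k choose j) * y ^ j * z ^ (n - k - j))"
      unfolding e by (simp add: mult_ac)
    finally show ?case unfolding a prod.case .
  qed auto
  also have "\<dots> = (\<Sum>j\<le>n. \<Sum>k\<le>n - j. int (n choose j) * y ^ j * (int (n - j choose k) * euler_num k * z ^ (n - j - k)))"
    unfolding sum.Sigma[OF finite_atMost ballI, OF finite_atMost] by (rule sum.cong) auto
  also have "\<dots> = (\<Sum>j\<le>n. int (n choose j) * y ^ j * euler_poly (n - j) z)"
    unfolding euler_poly_def by (simp add: sum_distrib_left)
  finally show ?thesis .
qed

text \<open>The scaled form of E_n(x+1) + E_n(x) = 2 x^n. Expanding around 1 and -1,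
  \<open>euler_poly_1\<close> removes every term except j = n.\<close>

lemma euler_poly_step: "euler_poly n (y + 1) + euler_poly n (y - 1) = 2 * y ^ n"
proof -
  have "euler_poly n (y + 1) + euler_poly n (y + - 1)
      = (\<Sum>j\<le>n. int (n choose j) * y ^ j * (euler_poly (n - j) 1 + euler_poly (n - j) (-1)))"
    unfolding euler_poly_add by (simp add: algebra_simps sum.distrib)
  also have "\<dots> = (\<Sum>j\<le>n. if j = n then 2 * y ^ n else 0)"
  proof (rule sum.cong)
    fix j assume "j \<in> {..n}"
    then show "int (n choose j) * y ^ j * (euler_poly (n - j) 1 + euler_poly (n - j) (-1))
        = (if j = n then 2 * y ^ n else 0)"
      using euler_poly_1[of "n - j"] by (cases "j = n") (simp_all add: euler_poly_0)
  qed simp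
  finally show ?thesis by simp
qed

text \<open>For even n the vanishing of the odd Euler numbers makes the polynomial even, so the two
  values in \<open>euler_poly_1\<close> coincide.\<close>

lemma euler_poly_1_even: "even n \<Longrightarrow> n > 0 \<Longrightarrow> euler_poly n 1 = 0"
proof -
  assume n: "even n" "n > 0"
  have "euler_poly n (-1) = euler_poly n 1"
    unfolding euler_poly_def
  proof (rule sum.cong)
    fix k assume "k \<in> {..n}"
    then show "int (n choose k) * euler_num k * (-1) ^ (n - k) = int (n choose k) * euler_num k * 1 ^ (n - k)"
      using n by (cases "even k") (simp_all add: euler_num_odd)
  qed simp
  then show ?thesis using euler_poly_1[OF n(2)] by simp
qed

text \<open>Starting from the value 0 at 1, \<open>euler_poly_step\<close> is iterated at the even
  points 2j.\<close>

lemma euler_poly_odd_arg: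
  assumes "even n" "n > 0"
  shows "euler_poly n (2 * int M + 1) = 2 * (-1) ^ M * (\<Sum>j=1..M. (-1) ^ j * (2 * int j) ^ n)"
proof (induction M)
  case 0
  then show ?case using euler_poly_1_even[OF assms] by simp
next
  case (Suc M)
  have "euler_poly n (2 * int (Suc M) + 1) = 2 * (2 * int (Suc M)) ^ n - euler_poly n (2 * int M + 1)"
    using euler_poly_step[of n "2 * int (Suc M)"] by (simp add: algebra_simps)
  also have "\<dots> = 2 * (-1) ^ Suc M * (\<Sum>j=1..Suc M. (-1) ^ j * (2 * int j) ^ n)"
    unfolding Suc by (simp add: algebra_simps del: of_nat_Suc)
  finally show ?case .
qed

text \<open>The constant coefficient is E_n. For a = p = 2m + 1 this links E_n modulo p with the
  alternating power sum of \<open>euler_poly_odd_arg\<close>.\<close>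

lemma euler_poly_dvd: "a dvd euler_poly n a - euler_num n"
proof -
  have "euler_poly n a = (\<Sum>k<n. int (n choose k) * euler_num k * a ^ (n - k)) + euler_num n"
    unfolding euler_poly_def by (simp flip: lessThan_Suc_atMost)
  moreover have "a dvd (\<Sum>k<n. int (n choose k) * euler_num k * a ^ (n - k))"
    by (intro dvd_sum) (simp add: dvd_power)
  ultimately show ?thesis by simp
qed

subsection \<open>The congruence modulo the fourth power of p\<close>

text \<open>With p = 2m + 1, these arrange 1, ..., p - 1 in pairs i, p - i and in pairs 2i, p - 2i.
  Comparing the two pairings drives the Wolstenholme and Morley congruences below.\<close>

lemma atLeastAtMost_double:
  fixes m :: nat
  shows "{1..2 * m} = {1..m} \<union> (\<lambda>i. 2 * m + 1 - i) ` {1..m}" (is ?A)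
  "{1..2 * m} = (\<lambda>i. 2 * i) ` {1..m} \<union> (\<lambda>i. 2 * m + 1 - 2 * i) ` {1..m}" (is ?B)
proof -
  show ?A
  proof (intro equalityI subsetI)
    fix x assume x: "x \<in> {1..2 * m}"
    show "x \<in> {1..m} \<union> (\<lambda>i. 2 * m + 1 - i) ` {1..m}"
    proof (cases "x \<le> m")
      case False
      then show ?thesis using x by (intro UnI2 image_eqI[of _ _ "2 * m + 1 - x"]) auto
    qed (use x in auto)
  qed auto
  show ?B
  proof (intro equalityI subsetI)
    fix x assume x: "x \<in> {1..2 * m}"
    show "x \<in> (\<lambda>i. 2 * i) ` {1..m} \<union> (\<lambda>i. 2 * m + 1 - 2 * i) ` {1..m}"
    proof (cases "even x")
      case True
      then show ?thesis using x by (intro UnI1 image_eqI[of _ _ "x div 2"]) auto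
    next
      case False
      then obtain y where "x = 2 * y + 1" by (elim oddE)
      then show ?thesis using x by (intro UnI2 image_eqI[of _ _ "m - y"]) auto
    qed
  qed auto
qed

lemma double_disjoint:
  fixes m :: nat
  shows "{1..m} \<inter> (\<lambda>i. 2 * m + 1 - i) ` {1..m} = {}"
  "(\<lambda>i. 2 * i) ` {1..m} \<inter> (\<lambda>i. 2 * m + 1 - 2 * i) ` {1..m} = {}"
  by auto presburger

lemma double_inj:
  fixes m :: nat
  shows "inj_on (\<lambda>i. 2 * m + 1 - i) {1..m}" "inj_on (\<lambda>i. 2 * m + 1 - 2 * i) {1..m}"
  by (auto intro!: inj_onI)

context comm_monoid_set
begin

text \<open>Proved for any commutative monoid, so that it serves sums and products alike.\<close>

lemma double_reflect:
  fixes m :: nat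
  shows "F g {1..2 * m} = F (\<lambda>i. g i \<^bold>* g (2 * m + 1 - i)) {1..m}"
  unfolding atLeastAtMost_double(1)
  by (subst union_disjoint[OF _ _ double_disjoint(1)])
    (simp_all only: finite_atLeastAtMost finite_imageI reindex[OF double_inj(1)] distrib o_def)

lemma double_parity:
  fixes m :: nat
  shows "F g {1..2 * m} = F (\<lambda>i. g (2 * i) \<^bold>* g (2 * m + 1 - 2 * i)) {1..m}"
proof -
  have "inj_on (\<lambda>i. 2 * i) {1..m}" by (auto intro!: inj_onI)
  then show ?thesis
    unfolding atLeastAtMost_double(2)
    by (subst union_disjoint[OF _ _ double_disjoint(2)])
      (simp_all only: finite_atLeastAtMost finite_imageI reindex[OF double_inj(2)] reindex distrib o_def)
qed

end

section \<open>Factorials, Pochhammer symbols and the summand\<close>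

lemma fact_prod_of_nat: "(fact n :: rat) = (\<Prod>i=1..n. of_nat i)"
  by (simp add: fact_prod)

lemma pochhammer_Suc_prod: "pochhammer (x + 1 :: rat) n = (\<Prod>i=1..n. x + of_nat i)"
proof -
  have "pochhammer (x + 1) n = (\<Prod>i<n. x + of_nat (Suc i))"
    unfolding pochhammer_prod by (simp add: add_ac atLeast0LessThan)
  then show ?thesis by (simp add: prod.atLeast1_atMost_eq)
qed

lemma fact_add: "(fact (n + k) :: rat) = fact n * pochhammer (of_nat n + 1) k"
  using pochhammer_product'[of "1::rat" n k] by (simp add: pochhammer_fact add.commute)

lemma fact_power4_dvd: "(fact n :: nat) ^ 4 dvd fact (4 * n)"
proof -
  have "(fact n * fact n) * (fact n * fact n) dvd (fact (n + n) * fact (n + n) :: nat)"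
    by (intro mult_dvd_mono fact_fact_dvd_fact)
  also have "\<dots> dvd fact ((n + n) + (n + n))" by (rule fact_fact_dvd_fact)
  also have "(n + n) + (n + n) = 4 * n" by simp
  finally show ?thesis by (simp only: power4_eq_xxxx mult.assoc)
qed

text \<open>The duplication formula, used twice, gives (4n)!/n!^4 = 64^n (1/2)_{2n} (1/2)_n / n!^3,
  and 2^10 = 16 * 64. The \<open>div\<close> is exact by \<open>fact_power4_dvd\<close>.\<close>

lemma summand_eq_wzF:
  "(of_nat (20 * n + 3) / (- (2 ^ 10)) ^ n) * of_nat (fact (4 * n) div (fact n) ^ 4) = wzF n 0"
proof -
  have "(fact (4 * n) :: rat) = 16 ^ n * pochhammer (1/2) (2 * n) * (4 ^ n * pochhammer (1/2) n * fact n)"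
    using fact_double[of "2 * n", where 'a = rat] fact_double[of n, where 'a = rat]
    by (simp add: power_mult)
  then have "of_nat (fact (4 * n) div (fact n) ^ 4)
      = (64 ^ n * pochhammer (1/2) (2 * n) * pochhammer (1/2) n / fact n ^ 3 :: rat)"
    using fact_power4_dvd[of n] power_mult_distrib[of "16 :: rat" 4 n]
    by (simp add: of_nat_of_nat_div power4_eq_xxxx power3_eq_cube mult_ac)
  moreover have "(- (2 ^ 10) :: rat) ^ n = (-1) ^ n * (16 ^ n * 64 ^ n)"
    by (simp flip: power_mult_distrib)
  ultimately show ?thesis by (simp only: wzF_def) (simp add: minus_one_power_iff mult_ac)
qed

section \<open>Wolstenholme's and Morley's congruences for p at least 5\<close>

locale odd_prime_5 = odd_prime +
  assumes p_ge5: "5 \<le> p"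
begin

definition m where "m = (p - 1) div 2"

abbreviation P :: rat where "P \<equiv> of_nat p"

lemma p_eq: "p = 2 * m + 1"
  using p_prime p_ge5 prime_odd_nat[of p] unfolding m_def by auto

lemma P_eq: "P = 2 * of_nat m + 1" by (subst p_eq) simp

lemma P_nonzero: "P \<noteq> 0" using p_ge by simp

lemma zp_unit_3: "3 \<in> zp_unit"
  using zp_unit_of_nat_less[of 3] p_ge5 by simp

text \<open>To first order a shift by t = p^2 c multiplies the product by 1 + t \<Sum> 1/x_i. The
  hypothesis on the sum supplies a third factor p, and t^2 is divisible by p^4.\<close>

lemma zcong_prod_shift:
  assumes "finite A" "\<And>i. i \<in> A \<Longrightarrow> x i \<in> zp_unit" "c \<in> zp" "zcong 1 (\<Sum>i\<in>A. 1 / x i) 0"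
  shows "zcong 3 (\<Prod>i\<in>A. x i + P ^ 2 * c) (\<Prod>i\<in>A. x i)"
proof -
  define t where "t = P ^ 2 * c"
  have t: "t \<in> zp" using assms(3) by (simp add: t_def)
  have "\<exists>z\<in>zp. (\<Prod>i\<in>A. x i + t) = (\<Prod>i\<in>A. x i) * (1 + t * (\<Sum>i\<in>A. 1 / x i)) + t ^ 2 * z"
    using assms(1,2)
  proof (induction A)
    case (insert a A)
    then obtain z where z: "z \<in> zp"
      "(\<Prod>i\<in>A. x i + t) = (\<Prod>i\<in>A. x i) * (1 + t * (\<Sum>i\<in>A. 1 / x i)) + t ^ 2 * z" by auto
    define Q S where "Q = (\<Prod>i\<in>A. x i)" and "S = (\<Sum>i\<in>A. 1 / x i)"
    have QS: "Q \<in> zp" "S \<in> zp" unfolding Q_def S_def using insert.prems by auto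
    have a: "x a \<noteq> 0" "x a \<in> zp" using insert.prems zp_unit_nonzero by auto
    have "(\<Prod>i\<in>insert a A. x i + t) = (x a + t) * (Q * (1 + t * S) + t ^ 2 * z)"
      using insert.hyps z by (simp add: Q_def S_def)
    also have "\<dots> = (x a * Q) * (1 + t * (1 / x a + S)) + t ^ 2 * (S * Q + z * (x a + t))"
      using a by (simp add: field_simps power2_eq_square)
    finally show ?case using insert.hyps QS a z t unfolding Q_def[symmetric] S_def[symmetric]
      by (intro bexI[of _ "S * Q + z * (x a + t)"]) (auto simp: Q_def S_def)
  qed (auto intro: bexI[of _ 0])
  then obtain z where z: "z \<in> zp"
    "(\<Prod>i\<in>A. x i + t) = (\<Prod>i\<in>A. x i) * (1 + t * (\<Sum>i\<in>A. 1 / x i)) + t ^ 2 * z" by blast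
  obtain s where s: "s \<in> zp" "(\<Sum>i\<in>A. 1 / x i) = P * s" using assms(4) unfolding zcong_def by auto
  have "(\<Prod>i\<in>A. x i + t) - (\<Prod>i\<in>A. x i) = P ^ 3 * (c * (\<Prod>i\<in>A. x i) * s + P * c ^ 2 * z)"
    unfolding z(2) s(2) by (simp add: t_def algebra_simps power2_eq_square power3_eq_cube)
  moreover have "c * (\<Prod>i\<in>A. x i) * s + P * c ^ 2 * z \<in> zp"
    using assms z s by auto
  ultimately show ?thesis unfolding zcong_def t_def by blast
qed

lemma zp_unit_index: "i \<in> {1..m} \<Longrightarrow> of_nat i \<in> zp_unit" "i \<in> {1..m} \<Longrightarrow> P - of_nat i \<in> zp_unit"
proof -
  assume i: "i \<in> {1..m}"
  then show "of_nat i \<in> zp_unit" using p_eq by auto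
  have "P - of_nat i = of_nat (p - i)" using i p_eq by (simp add: of_nat_diff)
  moreover have "0 < p - i" "p - i < p" using i p_eq by auto
  ultimately show "P - of_nat i \<in> zp_unit" by (metis zp_unit_of_nat_less)
qed

lemma zcong_P_diff: "zcong 1 (P - x) (- x)"
  using zcong_shift[of 1 "- x"] by simp

text \<open>Let T be this sum. Modulo p the sum of 1/i^2 over 1, ..., p - 1 is 2T by the pairs i, p
  - i and T/2 by the pairs 2i, p - 2i. So 3T/2 vanishes, and 3 is a unit for p \<ge> 5.\<close>

lemma sum_inverse_squares: "zcong 1 (\<Sum>i=1..m. 1 / of_nat i ^ 2) 0"
proof -
  define T where "T = (\<Sum>i=1..m. 1 / of_nat i ^ 2 :: rat)"
  define f where "f i = (1 / of_nat i ^ 2 :: rat)" for i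
  have refl: "zcong 1 (f (2 * m + 1 - i)) (1 / of_nat i ^ 2)" if "0 < i" "i \<le> 2 * m" for i
  proof -
    have e: "of_nat (2 * m + 1 - i) = P - of_nat i" using that p_eq by (simp add: of_nat_diff)
    have "zcong 1 ((P - of_nat i) ^ 2) ((- of_nat i) ^ 2)"
      by (intro zcong_power zcong_P_diff) simp
    moreover have "of_nat i \<in> zp_unit" "of_nat (2 * m + 1 - i) \<in> zp_unit"
      by (rule zp_unit_of_nat_less; use that p_eq in linarith)+
    ultimately show ?thesis unfolding f_def e by (intro zcong_divide) auto
  qed
  have "zcong 1 (\<Sum>i=1..2 * m. f i) (\<Sum>i=1..m. f i + f i)"
    unfolding sum.double_reflect[of f] by (intro zcong_sum zcong_add refl[unfolded f_def[symmetric]] zcong_refl) auto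
  moreover have "(\<Sum>i=1..m. f i + f i) = 2 * T"
    unfolding T_def f_def by (simp add: sum_distrib_left)
  moreover have "zcong 1 (\<Sum>i=1..2 * m. f i) (\<Sum>i=1..m. f (2 * i) + f (2 * i))"
    unfolding sum.double_parity[of f] by (intro zcong_sum zcong_add refl[unfolded f_def[symmetric]] zcong_refl) auto
  moreover have "(\<Sum>i=1..m. f (2 * i) + f (2 * i)) = T / 2"
    by (simp add: T_def f_def sum.distrib sum_divide_distrib field_simps)
  ultimately have "zcong 1 (2 * T) (T / 2)" by (metis zcong_sym zcong_trans)
  from zcong_diff[OF this zcong_refl[of 1 "T / 2"]] have "zcong 1 (T * (3 / 2)) (0 * (3 / 2))" by (simp add: mult.commute)
  then show ?thesis unfolding T_def by (rule zcong_cancel) (simp add: zp_unit_3)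
qed

lemma sum_inverse_products: "zcong 1 (\<Sum>i=1..m. 1 / (of_nat i * (P - of_nat i))) 0"
proof -
  have "zcong 1 (\<Sum>i=1..m. 1 / (of_nat i * (P - of_nat i))) (\<Sum>i=1..m. 1 / (of_nat i * (- of_nat i)))"
    by (intro zcong_sum zcong_divide zcong_mult zcong_P_diff zcong_refl) (use zp_unit_index in auto)
  also have "(\<Sum>i=1..m. 1 / (of_nat i * (- of_nat i))) = - (\<Sum>i=1..m. 1 / of_nat i ^ 2 :: rat)"
    by (simp add: power2_eq_square sum_negf)
  also have "zcong 1 \<dots> (- 0)" by (intro zcong_minus sum_inverse_squares)
  finally show ?thesis by simp
qed

text \<open>Wolstenholme's congruence: 1/i + 1/(p-i) = p/(i(p-i)), and the remaining sum is
  divisible by p once more.\<close>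

lemma harmonic: "zcong 2 (\<Sum>i=1..2 * m. 1 / of_nat i) 0"
proof -
  have "(\<Sum>i=1..2 * m. 1 / of_nat i) = (\<Sum>i=1..m. P * (1 / (of_nat i * (P - of_nat i))))"
    unfolding sum.double_reflect
  proof (rule sum.cong)
    fix i assume i: "i \<in> {1..m}"
    then have e: "of_nat (2 * m + 1 - i) = P - of_nat i" using p_eq by (simp add: of_nat_diff)
    show "1 / of_nat i + 1 / of_nat (2 * m + 1 - i) = P * (1 / (of_nat i * (P - of_nat i)))"
      unfolding e using zp_unit_nonzero[OF zp_unit_index(1)[OF i]] zp_unit_nonzero[OF zp_unit_index(2)[OF i]]
      by (simp add: field_simps)
  qed simp
  also have "\<dots> = P ^ 1 * (\<Sum>i=1..m. 1 / (of_nat i * (P - of_nat i)))"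
    by (simp add: sum_distrib_left)
  also have "zcong (1 + 1) \<dots> (P ^ 1 * 0)"
    unfolding zcong_scale by (rule sum_inverse_products)
  finally show ?thesis by (simp add: numeral_2_eq_2)
qed

text \<open>This is (p-1)!/m!, so \<open>upper / fact m\<close> is the central binomial coefficient
  (p-1 choose m) of Morley's congruence.\<close>

definition upper :: rat where "upper = (\<Prod>i=1..m. P - of_nat i)"

lemma fact_upper: "fact (2 * m) = fact m * upper"
proof -
  have "(fact (2 * m) :: rat) = (\<Prod>i=1..m. of_nat i * of_nat (2 * m + 1 - i))"
    unfolding fact_prod_of_nat prod.double_reflect ..
  also have "\<dots> = (\<Prod>i=1..m. of_nat i * (P - of_nat i))"
    using p_eq by (intro prod.cong) (auto simp: of_nat_diff)
  finally show ?thesis by (simp add: prod.distrib fact_prod_of_nat upper_def)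
qed

lemma zp_unit_fact_m [simp]: "fact m \<in> zp_unit" "fact (2 * m) \<in> zp_unit"
  using p_eq by auto

lemma upper_zp_unit [simp]: "upper \<in> zp_unit"
  unfolding upper_def by (intro zp_unit_prod zp_unit_index)

lemma morley: "zcong 3 upper ((-16) ^ m * fact m)"
proof -
  \<comment> \<open>Q is the product of the odd numbers below p. Its square has the factors (p-2i)^2
    = -4i(p-i) + p^2, so modulo p^3 it is (-4)^m (p-1)!, which is again a multiple of Q.\<close>
  define Q where "Q = (\<Prod>i=1..m. P - 2 * of_nat i)"
  have "(fact (2 * m) :: rat) = (\<Prod>i=1..m. of_nat (2 * i) * of_nat (2 * m + 1 - 2 * i))"
    unfolding fact_prod_of_nat prod.double_parity ..
  also have "\<dots> = (\<Prod>i=1..m. 2 * of_nat i * (P - 2 * of_nat i))"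
    using p_eq by (intro prod.cong) (auto simp: of_nat_diff)
  also have "\<dots> = fact m * (2 ^ m * Q)"
    by (simp only: prod.distrib fact_prod_of_nat[symmetric] Q_def) simp
  finally have U: "upper = 2 ^ m * Q" unfolding fact_upper by simp
  then have "Q = upper / 2 ^ m" by simp
  then have Q: "Q \<in> zp_unit" by simp
  have "Q ^ 2 = (\<Prod>i=1..m. (-4) * (of_nat i * (P - of_nat i)) + P ^ 2 * 1)"
    unfolding Q_def prod_power_distrib
    by (intro prod.cong) (auto simp: algebra_simps power2_eq_square)
  also have "zcong 3 \<dots> (\<Prod>i=1..m. (-4) * (of_nat i * (P - of_nat i)))"
  proof (rule zcong_prod_shift)
    have "(\<Sum>i=1..m. 1 / (- 4 * (of_nat i * (P - of_nat i)))) = (-1/4) * (\<Sum>i=1..m. 1 / (of_nat i * (P - of_nat i)))"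
      by (simp add: sum_distrib_left)
    also have "zcong 1 \<dots> ((-1/4) * 0)" by (intro zcong_mult_left sum_inverse_products) simp
    finally show "zcong 1 (\<Sum>i=1..m. 1 / (- 4 * (of_nat i * (P - of_nat i)))) 0" by simp
  qed (use zp_unit_index in auto)
  also have "(\<Prod>i=1..m. (-4) * (of_nat i * (P - of_nat i))) = (-4) ^ m * (fact m * upper)"
    by (simp only: prod.distrib fact_prod_of_nat upper_def) simp
  also have "\<dots> = ((-8) ^ m * fact m) * Q"
    unfolding U by (simp flip: power_mult_distrib)
  finally have "zcong 3 (Q * Q) (((-8) ^ m * fact m) * Q)" by (simp add: power2_eq_square)
  then have "zcong 3 Q ((-8) ^ m * fact m)" using Q by (rule zcong_cancel)
  from zcong_mult_left[OF this, of "2 ^ m"] show ?thesis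
    unfolding U by (simp add: mult.assoc[symmetric] power_mult_distrib[symmetric])
qed

text \<open>Pairing i with p - i gives the factors i(p-i) + 3p^2/4, to which
  \<open>zcong_prod_shift\<close> applies.\<close>

lemma poch_half_P: "zcong 3 (pochhammer (P / 2 + 1) (2 * m)) (fact m * upper)"
proof -
  have "pochhammer (P / 2 + 1) (2 * m) = (\<Prod>i=1..m. of_nat i * (P - of_nat i) + P ^ 2 * (3 / 4))"
    unfolding pochhammer_Suc_prod prod.double_reflect
  proof (intro prod.cong)
    fix i assume i: "i \<in> {1..m}"
    then have e: "of_nat (2 * m + 1 - i) = P - of_nat i" using p_eq by (simp add: of_nat_diff)
    show "(P / 2 + of_nat i) * (P / 2 + of_nat (2 * m + 1 - i)) = of_nat i * (P - of_nat i) + P ^ 2 * (3 / 4)"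
      unfolding e by (simp add: field_simps power2_eq_square)
  qed simp
  also have "zcong 3 \<dots> (\<Prod>i=1..m. of_nat i * (P - of_nat i))"
    by (intro zcong_prod_shift sum_inverse_products) (use zp_unit_index in auto)
  also have "\<dots> = fact m * upper" by (simp add: prod.distrib fact_prod_of_nat upper_def)
  finally show ?thesis .
qed

section \<open>The terms F(n,m)\<close>

text \<open>A source of factors p: splitting a Pochhammer symbol of 1/2 at index m leaves one that
  starts at p/2.\<close>

lemma half_plus_m: "1 / 2 + of_nat m = P / 2" by (simp add: P_eq field_simps)

lemma m_plus_1: "of_nat m + 1 = P / 2 + 1 / 2" by (simp add: P_eq field_simps)

lemma poch_half_nonzero [simp]: "pochhammer (1 / 2 :: rat) k \<noteq> 0"
  using pochhammer_half_pos[of k] by linarith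

text \<open>The linear factor 18m + 3 = 6 (p/2 + 2m) completes (p/2)_{2m} to (p/2)_{2m+1} = p/2 (p/2
  + 1)_{2m}. One p splits off, and \<open>poch_half_P\<close> and \<open>morley\<close> evaluate the
  cofactor modulo p^3.\<close>

lemma wzF_diagonal: "zcong 4 (wzF m m) (3 * P * (-1) ^ m)"
proof -
  define V where "V = pochhammer (P / 2 + 1) (2 * m)"
  have "pochhammer (P / 2) (2 * m + 1) = P / 2 * V"
    unfolding V_def by (simp add: pochhammer_rec)
  moreover have "pochhammer (P / 2) (2 * m + 1) = pochhammer (P / 2) (2 * m) * (P / 2 + 2 * of_nat m)"
    by (simp add: pochhammer_rec')
  ultimately have "pochhammer (P / 2) (2 * m) * (P / 2 + 2 * of_nat m) = P / 2 * V" by simp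
  then have V: "(20 * of_nat m - 2 * of_nat m + 3) * pochhammer (P / 2) (2 * m) = 3 * P * V"
    by (simp add: P_eq field_simps)
  have "wzF m m = (20 * of_nat m - 2 * of_nat m + 3) * pochhammer (P / 2) (2 * m) / (fact m ^ 2 * 16 ^ m)"
  proof -
    have q: "pochhammer (1 / 2) (2 * m + m) = pochhammer (1 / 2) m * pochhammer (P / 2) (2 * m)"
      unfolding half_plus_m[symmetric] add.commute[of "2 * m"] by (rule pochhammer_product')
    show ?thesis unfolding wzF_def q by (simp add: power2_eq_square power3_eq_cube flip: mult_2 power_mult)
  qed
  also have "\<dots> = P ^ 1 * (3 * V / (fact m ^ 2 * 16 ^ m))" unfolding V by simp
  finally have *: "wzF m m = P ^ 1 * (3 * V / (fact m ^ 2 * 16 ^ m))" .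
  have "zcong 3 V (fact m * upper)" unfolding V_def by (rule poch_half_P)
  also have "zcong 3 (fact m * upper) (fact m * ((-16) ^ m * fact m))"
    by (intro zcong_mult_left morley) simp
  finally have "zcong 3 (3 * V / (fact m ^ 2 * 16 ^ m)) (3 * (fact m * ((-16) ^ m * fact m)) / (fact m ^ 2 * 16 ^ m))"
    by (intro zcong_divide zcong_mult_left zcong_refl) (auto simp: V_def)
  also have "3 * (fact m * ((-16) ^ m * fact m)) / (fact m ^ 2 * 16 ^ m) = (3 * (-1) ^ m :: rat)"
    using power_mult_distrib[of "-1 :: rat" 16 m] by (simp add: power2_eq_square)
  finally have "zcong (3 + 1) (wzF m m) (P ^ 1 * (3 * (-1) ^ m))"
    unfolding * zcong_scale .
  then show ?thesis by (simp add: mult_ac)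
qed

text \<open>The common residue modulo p of \<open>wzF (m + Suc j) m\<close> divided by p^3, up to a
  factor free of j, and of \<open>harmF j p\<close> divided by p.\<close>

definition harm_term :: "nat \<Rightarrow> rat" where
  "harm_term j = (-1) ^ Suc j * (20 * of_nat j + 14) * fact j * fact (2 * j)
     / (fact (Suc j) * pochhammer (1 / 2) (Suc j) ^ 2 * 16 ^ Suc j)"

lemma poch_cg_fact:
  assumes "c \<in> zp"
  shows "zcong 1 (pochhammer (P * c + 1) k) (fact k)"
  unfolding pochhammer_fact by (intro zcong_pochhammer zcong_shift) (use assms in auto)

text \<open>By \<open>m_plus_1\<close> this is (m+j+1)!/m!, and m + j + 1 < p.\<close>

lemma poch_P_half: "j < m \<Longrightarrow> pochhammer (P / 2 + 1 / 2) (Suc j) \<in> zp_unit"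
proof -
  assume j: "j < m"
  have "(fact (m + Suc j) :: rat) = fact m * pochhammer (P / 2 + 1 / 2) (Suc j)"
    unfolding fact_add m_plus_1 ..
  then have "pochhammer (P / 2 + 1 / 2) (Suc j) = fact (m + Suc j) / fact m" by simp
  moreover have "(fact (m + Suc j) :: rat) \<in> zp_unit" using j p_eq by (intro zp_unit_fact) simp
  ultimately show ?thesis by (metis zp_unit_divide zp_unit_fact_m(1))
qed

lemma zcong_P_half: "zcong 1 (P / 2 + x) x"
  using zcong_shift[of "1 / 2" x] by simp

lemma poch_half_unit: "j < m \<Longrightarrow> pochhammer (1 / 2) (Suc j) \<in> zp_unit"
  using zcong_zp_unit[of 1 "pochhammer (P / 2 + 1 / 2) (Suc j)" "pochhammer (1 / 2) (Suc j)"] poch_P_half[of j]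
    zcong_pochhammer[OF zcong_P_half, of "1 / 2" "Suc j"] by simp

text \<open>Three multiples of p split off: p/2 in (1/2)_{m+j+1}, and p/2 and 3p/2 in
  (1/2)_{3m+2j+2}. Their coefficients give 3/8; the rest is reduced modulo p.\<close>

lemma wzF_above:
  assumes "j < m"
  shows "zcong 4 (wzF (m + Suc j) m) (P ^ 3 * (3 / 8 * fact (2 * m) / (fact m ^ 2 * 16 ^ m) * harm_term j))"
proof -
  define A B C D where "A = pochhammer (P / 2 + 1) j" and "B = pochhammer (P / 2 + 1) (2 * m)"
    and "C = pochhammer (3 * P / 2 + 1) (2 * j)" and "D = pochhammer (P / 2 + 1 / 2) (Suc j)"
  define X where "X = (-1) ^ Suc j * (9 * P + (20 * of_nat j + 14)) * (3 / 8) * A * B * C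
     / (fact (Suc j) * fact m ^ 2 * 16 ^ m * D ^ 2 * 16 ^ Suc j)"
  have h: "pochhammer (1 / 2) (m + Suc j) = pochhammer (1 / 2) m * (P / 2 * A)"
    unfolding pochhammer_product' half_plus_m by (simp add: pochhammer_rec A_def)
  have e: "P / 2 + of_nat (2 * m + 1) = 3 * P / 2" by (simp add: P_eq)
  have "2 * (m + Suc j) + m = m + (2 * m + 1 + (1 + 2 * j))" by simp
  then have "pochhammer (1 / 2) (2 * (m + Suc j) + m) = pochhammer (1 / 2) m * (pochhammer (P / 2) (2 * m + 1) * pochhammer (3 * P / 2) (1 + 2 * j))"
    unfolding e[symmetric] half_plus_m[symmetric] pochhammer_product'[symmetric] by simp
  also have "\<dots> = pochhammer (1 / 2) m * (P / 2 * B * (3 * P / 2 * C))"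
    by (simp add: pochhammer_rec B_def C_def)
  finally have k: "pochhammer (1 / 2) (2 * (m + Suc j) + m) = \<dots>" .
  have f: "(fact (m + Suc j) :: rat) = fact m * D"
    unfolding fact_add m_plus_1 D_def ..
  have "of_nat (m + Suc j choose m) * fact m * fact (Suc j) = (fact (m + Suc j) :: rat)"
    by (simp add: binomial_fact)
  then have c: "of_nat (m + Suc j choose m) * fact m = (fact m * D / fact (Suc j) :: rat)"
    unfolding f by (simp add: field_simps del: fact_Suc)
  have D0: "D \<noteq> 0" "D \<in> zp_unit" using poch_P_half[OF assms] zp_unit_nonzero unfolding D_def by auto
  have s: "(-1) ^ (m + Suc j + m) = ((-1) ^ Suc j :: rat)"
    by (simp add: power_add)
  have l: "20 * of_nat (m + Suc j) - 2 * of_nat m + 3 = 9 * P + (20 * of_nat j + 14)"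
    by (simp add: P_eq)
  have "wzF (m + Suc j) m = (-1) ^ Suc j * (9 * P + (20 * of_nat j + 14)) * (pochhammer (1 / 2) m * (P / 2 * A))
     * (pochhammer (1 / 2) m * (P / 2 * B * (3 * P / 2 * C))) * (fact m * D / fact (Suc j))
     / ((fact m * D) ^ 3 * pochhammer (1 / 2) m ^ 2 * (16 ^ m * 16 ^ Suc j))"
    unfolding wzF_def s l h k f c[symmetric] power_add[symmetric] by (simp add: mult_ac)
  also have "\<dots> = P ^ 3 * X"
    unfolding X_def using D0 by (simp add: power2_eq_square power3_eq_cube mult_ac del: fact_Suc power_Suc)
  finally have 1: "wzF (m + Suc j) m = P ^ 3 * X" .
  have fj: "fact (Suc j) \<in> zp_unit" using assms p_eq by (intro zp_unit_fact) simp
  have "zcong 1 X ((-1) ^ Suc j * (20 * of_nat j + 14) * (3 / 8) * fact j * fact (2 * m) * fact (2 * j)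
     / (fact (Suc j) * fact m ^ 2 * 16 ^ m * pochhammer (1 / 2) (Suc j) ^ 2 * 16 ^ Suc j))"
    unfolding X_def A_def B_def C_def D_def
  proof (intro zcong_divide zcong_mult zcong_refl)
    show "zcong 1 (9 * P + (20 * of_nat j + 14)) (20 * of_nat j + 14)"
      using zcong_shift[of 9] by (simp add: mult.commute)
    show "zcong 1 (pochhammer (P / 2 + 1) j) (fact j)"
         "zcong 1 (pochhammer (P / 2 + 1) (2 * m)) (fact (2 * m))"
      using poch_cg_fact[of "1 / 2"] by simp_all
    show "zcong 1 (pochhammer (3 * P / 2 + 1) (2 * j)) (fact (2 * j))"
      using poch_cg_fact[of "3 / 2"] by (simp add: mult.commute)
    show "zcong 1 (pochhammer (P / 2 + 1 / 2) (Suc j) ^ 2) (pochhammer (1 / 2) (Suc j) ^ 2)"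
      by (intro zcong_power zcong_pochhammer zcong_P_half) auto
  qed (use poch_half_unit[OF assms] D0(2)[unfolded D_def] fj in \<open>simp_all del: fact_Suc power_Suc pochhammer_Suc\<close>)
  also have "\<dots> = 3 / 8 * fact (2 * m) / (fact m ^ 2 * 16 ^ m) * harm_term j"
    unfolding harm_term_def by (simp add: mult_ac del: fact_Suc power_Suc)
  finally have "zcong (1 + 3) (P ^ 3 * X) (P ^ 3 * (3 / 8 * fact (2 * m) / (fact m ^ 2 * 16 ^ m) * harm_term j))"
    unfolding zcong_scale .
  then show ?thesis unfolding 1 by simp
qed

text \<open>The factor p comes from (p+1 choose 2j+2); the p in p! cancels against the one in
  (p+j+1)!.\<close>

lemma harmF_zcong:
  assumes "j < m"
  shows "\<exists>Y. harmF j p = P * Y \<and> zcong 1 Y (harm_term j)"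
proof -
  define A B where "A = pochhammer (P - 2 * of_nat j) (2 * j)" and "B = pochhammer (P + 1) (Suc j)"
  define Y where "Y = (-1) ^ Suc j * (2 * P + (20 * of_nat j + 14)) * fact j * fact (Suc j) ^ 2 * fact (p - 1) * A
     / (fact (p - 1) * B * fact (2 * j + 2) ^ 2)"
  have jp: "2 * j + 2 \<le> p - 1" using assms p_eq by simp
  have pf: "(fact p :: rat) = P * fact (p - 1)" using p_ge by (simp add: fact_reduce)
  have "(fact (p - 1 - 2 * j + 2 * j) :: rat) = fact (p - 1 - 2 * j) * pochhammer (of_nat (p - 1 - 2 * j) + 1) (2 * j)"
    by (rule fact_add)
  moreover have "of_nat (p - 1 - 2 * j) + 1 = P - 2 * of_nat j" "p - 1 - 2 * j + 2 * j = p - 1"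
    using jp by (simp_all add: of_nat_diff)
  ultimately have a: "(fact (p - 1) :: rat) = fact (p - 1 - 2 * j) * A" unfolding A_def by simp
  then have A0: "A \<noteq> 0" by auto
  have b: "(fact (Suc j + p) :: rat) = fact p * B"
    using fact_add[of p "Suc j"] unfolding B_def by (simp add: add.commute)
  have "B > 0" unfolding B_def by (intro pochhammer_pos) (simp add: add_nonneg_pos)
  then have B0: "B \<noteq> 0" by simp
  have e: "Suc p - (2 * j + 2) = p - 1 - 2 * j" by simp
  have "of_nat (Suc p choose (2 * j + 2)) = (fact (Suc p) / (fact (2 * j + 2) * fact (p - 1 - 2 * j)) :: rat)"
    using jp binomial_fact[of "2 * j + 2" "Suc p", where 'a = rat] unfolding e by simp
  also have "fact (p - 1 - 2 * j) = (fact (p - 1) / A :: rat)" using a A0 by simp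
  also have "(fact (Suc p) :: rat) = of_nat (Suc p) * (P * fact (p - 1))" using pf by simp
  finally have c: "of_nat (Suc p choose (2 * j + 2)) = of_nat (Suc p) * P * A / fact (2 * j + 2)"
    using A0 by (simp del: of_nat_Suc)
  have "harmF j p = (-1) ^ Suc j * (20 * of_nat j + 2 * P + 14) * fact j * fact (Suc j) ^ 2 * (P * fact (p - 1))
     * (of_nat (Suc p) * P * A / fact (2 * j + 2)) / ((P * fact (p - 1) * B) * of_nat (Suc p) * fact (2 * j + 2))"
    unfolding harmF_def c b pf ..
  also have "\<dots> = P * Y"
    unfolding Y_def using A0 B0 P_nonzero by (simp add: power2_eq_square mult_ac add_ac del: of_nat_Suc fact_Suc power_Suc)
  finally have 1: "harmF j p = P * Y" .
  have B1: "zcong 1 B (fact (Suc j))" unfolding B_def using poch_cg_fact[of 1 "Suc j"] by (simp del: fact_Suc)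
  have fj: "fact (Suc j) \<in> zp_unit" "fact (2 * j + 2) \<in> zp_unit" using jp p_ge by (intro zp_unit_fact; linarith)+
  have Bu: "B \<in> zp_unit" using zcong_zp_unit[OF B1] fj by simp
  have fp: "fact (p - 1) \<in> zp_unit" using p_ge by (intro zp_unit_fact) simp
  have "zcong 1 A (pochhammer (- of_nat (2 * j)) (2 * j))"
    unfolding A_def using zcong_P_diff[of "2 * of_nat j"] by (intro zcong_pochhammer) auto
  then have A1: "zcong 1 A (fact (2 * j))" unfolding pochhammer_same by simp
  have Az: "A \<in> zp" unfolding A_def by simp
  have "zcong 1 Y ((-1) ^ Suc j * (20 * of_nat j + 14) * fact j * fact (Suc j) ^ 2 * fact (p - 1) * fact (2 * j)
     / (fact (p - 1) * fact (Suc j) * fact (2 * j + 2) ^ 2))"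
    unfolding Y_def
  proof (intro zcong_divide zcong_mult zcong_refl A1 B1)
    show "zcong 1 (2 * P + (20 * of_nat j + 14)) (20 * of_nat j + 14)"
      using zcong_shift[of 2] by (simp add: mult.commute)
  qed (use fj fp Bu Az in \<open>simp_all del: fact_Suc power_Suc\<close>)
  also have "\<dots> = harm_term j"
  proof -
    \<comment> \<open>The duplication formula brings in the squared Pochhammer symbol and the power
      of 16 of \<open>harm_term\<close>.\<close>
    have d: "(fact (2 * j + 2) :: rat) = 4 ^ Suc j * pochhammer (1 / 2) (Suc j) * fact (Suc j)"
      using fact_double[of "Suc j", where 'a = rat] by (simp add: power_mult)
    have "(4 :: rat) ^ Suc j * 4 ^ Suc j = 16 ^ Suc j" unfolding power_mult_distrib[symmetric] by simp
    then have "(fact (2 * j + 2) :: rat) ^ 2 = 16 ^ Suc j * pochhammer (1 / 2) (Suc j) ^ 2 * fact (Suc j) ^ 2"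
      unfolding d by (simp add: power2_eq_square mult_ac del: power_Suc fact_Suc pochhammer_Suc)
    then show ?thesis unfolding harm_term_def
      by (simp add: power2_eq_square mult_ac del: power_Suc fact_Suc)
  qed
  finally show ?thesis using 1 by blast
qed

text \<open>At j = m the binomial coefficient is 1 and (2m+2)! = (p+1)! puts a p into the
  denominator. What is left involves \<Prod> (p+i)(p-i) = \<Prod> (p^2 - i^2), which is (-1)^m m!^2
  modulo p^3.\<close>

lemma harmF_last: "zcong 3 (P * harmF m p) (-2)"
proof -
  define A where "A = pochhammer (P + 1) m"
  have "(fact p :: rat) = P * fact (p - 1)" using p_ge by (simp add: fact_reduce)
  moreover have "p - 1 = 2 * m" using p_eq by simp
  ultimately have pf: "(fact p :: rat) = P * (fact m * upper)" using fact_upper by (simp only:)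
  have "pochhammer (P + 1) (Suc m) = A * (P + 1 + of_nat m)" unfolding A_def by (simp add: pochhammer_rec' mult.commute)
  then have b: "(fact (Suc m + p) :: rat) = P * (fact m * upper) * (A * ((3 * P + 1) / 2))"
    using fact_add[of p "Suc m"] pf by (simp add: add.commute P_eq)
  have "A > 0" unfolding A_def by (intro pochhammer_pos) (simp add: add_nonneg_pos)
  then have A0: "A \<noteq> 0" by simp
  have U0: "upper \<noteq> 0" using zp_unit_nonzero[OF upper_zp_unit] .
  have P1: "P + 1 \<noteq> 0" "3 * P + 1 \<noteq> 0" by (simp_all add: add_nonneg_eq_0_iff)
  have e: "2 * m + 2 = Suc p" using p_eq by simp
  have m1: "(fact (Suc m) :: rat) = (P + 1) / 2 * fact m" by (simp add: P_eq field_simps)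
  have "harmF m p = (-1) ^ Suc m * (20 * of_nat m + 2 * P + 14) * fact m * ((P + 1) / 2 * fact m) ^ 2 * (P * (fact m * upper))
     / (P * (fact m * upper) * (A * ((3 * P + 1) / 2)) * (P + 1) * ((P + 1) * (P * (fact m * upper))))"
    unfolding harmF_def e b m1 fact_Suc[of p] pf by (simp add: add_ac)
  \<comment> \<open>This cancels the last factor p + 1 + m = (3p+1)/2 of (p+1)_{m+1}.\<close>
  also have "20 * of_nat m + 2 * P + 14 = 4 * (3 * P + 1)" by (simp add: P_eq)
  finally have "P * harmF m p = P * ((-1) ^ Suc m * (4 * (3 * P + 1)) * fact m * ((P + 1) / 2 * fact m) ^ 2 * (P * (fact m * upper))
     / (P * (fact m * upper) * (A * ((3 * P + 1) / 2)) * (P + 1) * ((P + 1) * (P * (fact m * upper)))))" by simp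
  also have "\<dots> = 2 * (-1) ^ Suc m * (fact m ^ 2 / (A * upper))"
  proof -
    have "P * (s * (4 * q) * f * (r / 2 * f) ^ 2 * (P * (f * u)) / (P * (f * u) * (a * (q / 2)) * r * (r * (P * (f * u)))))
        = 2 * s * (f ^ 2 / (a * u))" if "q \<noteq> 0" "r \<noteq> 0" "f \<noteq> 0" "u \<noteq> 0" "a \<noteq> 0" for q r f u a s
      using that P_nonzero by (simp add: power2_eq_square)
    from this[OF P1(2) P1(1) fact_nonzero U0 A0] show ?thesis .
  qed
  finally have "P * harmF m p = 2 * (-1) ^ Suc m * (fact m ^ 2 / (A * upper))" .
  moreover have "zcong 3 (A * upper) ((-1) ^ m * fact m ^ 2)"
  proof -
    have "A * upper = (\<Prod>i=1..m. - (of_nat i ^ 2) + P ^ 2 * 1)"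
      unfolding A_def pochhammer_Suc_prod upper_def prod.distrib[symmetric]
      by (intro prod.cong) (auto simp: algebra_simps power2_eq_square)
    also have "zcong 3 \<dots> (\<Prod>i=1..m. - (of_nat i ^ 2))"
    proof (rule zcong_prod_shift)
      have "(\<Sum>i=1..m. 1 / - (of_nat i ^ 2)) = - (\<Sum>i=1..m. 1 / of_nat i ^ 2 :: rat)"
        by (simp add: sum_negf)
      also have "zcong 1 \<dots> (- 0)" by (intro zcong_minus sum_inverse_squares)
      finally show "zcong 1 (\<Sum>i=1..m. 1 / - (of_nat i ^ 2)) 0" by simp
    qed (use zp_unit_index in auto)
    also have "(\<Prod>i=1..m. - (of_nat i ^ 2) :: rat) = (-1) ^ m * fact m ^ 2"
      by (simp add: fact_prod_of_nat prod_power_distrib prod_uminus)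
    finally show ?thesis .
  qed
  then have "zcong 3 (fact m ^ 2 / (A * upper)) (fact m ^ 2 / ((-1) ^ m * fact m ^ 2))"
    using zcong_zp_unit[of 3 "A * upper" "(-1) ^ m * fact m ^ 2"] by (intro zcong_divide zcong_refl) auto
  then have "zcong 3 (2 * (-1) ^ Suc m * (fact m ^ 2 / (A * upper))) (2 * (-1) ^ Suc m * (fact m ^ 2 / ((-1) ^ m * fact m ^ 2)))"
    by (intro zcong_mult_left) auto
  moreover have "2 * (-1) ^ Suc m * (fact m ^ 2 / ((-1) ^ m * fact m ^ 2)) = (- 2 :: rat)" by simp
  ultimately show ?thesis by simp
qed

text \<open>Multiply \<open>harmF_sum\<close> at l = p by p. The poles match: p times the last term
  is -2, as is -2p * (1/p), and p H_{p-1} vanishes modulo p^3 by Wolstenholme. So p^2 times the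
  remaining sum is 0 modulo p^3.\<close>

lemma harm_term_sum: "zcong 1 (\<Sum>j<m. harm_term j) 0"
proof -
  have "\<forall>j\<in>{..<m}. \<exists>Y. harmF j p = P * Y \<and> zcong 1 Y (harm_term j)" using harmF_zcong by blast
  then obtain Y where Y: "\<And>j. j < m \<Longrightarrow> harmF j p = P * Y j" "\<And>j. j < m \<Longrightarrow> zcong 1 (Y j) (harm_term j)"
    by (metis lessThan_iff)
  define H where "H = (\<Sum>i=1..2 * m. 1 / of_nat i :: rat)"
  have "(\<Sum>j<Suc m. harmF j p) = -2 * (\<Sum>i=1..p. 1 / of_nat i)"
    using p_eq by (intro harmF_sum) simp
  also have "(\<Sum>i=1..p. 1 / of_nat i) = H + 1 / P"
  proof -
    have e: "{1..p} = {1..Suc (2 * m)}" using p_eq by simp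
    show ?thesis unfolding e H_def P_eq by simp
  qed
  also have "(\<Sum>j<Suc m. harmF j p) = P * (\<Sum>j<m. Y j) + harmF m p"
    using Y(1) by (simp add: sum_distrib_left)
  finally have q: "P * (\<Sum>j<m. Y j) + harmF m p = -2 * (H + 1 / P)" .
  have h: "zcong 3 (P ^ 1 * H) (P ^ 1 * 0)"
    using zcong_scale[of 2 1 H 0] harmonic unfolding H_def by (simp add: numeral_3_eq_3)
  have "P ^ 2 * (\<Sum>j<m. Y j) = P * (P * (\<Sum>j<m. Y j) + harmF m p) - P * harmF m p"
    by (simp add: algebra_simps power2_eq_square)
  also have "\<dots> = (- 2) * (P ^ 1 * H) + (- 2 - P * harmF m p)"
    unfolding q using P_nonzero by (simp add: algebra_simps)
  also have "zcong 3 \<dots> ((- 2) * (P ^ 1 * 0) + (- 2 - (- 2)))"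
    by (intro zcong_add[OF zcong_mult_left[OF h] zcong_diff[OF zcong_refl harmF_last]]) simp
  finally have "zcong (1 + 2) (P ^ 2 * (\<Sum>j<m. Y j)) (P ^ 2 * 0)" by (simp add: numeral_3_eq_3)
  then have "zcong 1 (\<Sum>j<m. Y j) 0" unfolding zcong_scale .
  moreover have "zcong 1 (\<Sum>j<m. Y j) (\<Sum>j<m. harm_term j)" using Y(2) by (intro zcong_sum) auto
  ultimately show ?thesis by (metis zcong_sym zcong_trans)
qed

text \<open>Terms with n < m vanish with their binomial coefficient, n = m gives the main term, and
  the terms with n > m cancel by \<open>harm_term_sum\<close>.\<close>

lemma wzF_sum: "zcong 4 (\<Sum>n<p. wzF n m) (3 * P * (-1) ^ m)"
proof -
  define K where "K = 3 / 8 * fact (2 * m) / (fact m ^ 2 * 16 ^ m :: rat)"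
  have K: "K \<in> zp" unfolding K_def by simp
  have "{..<p} = {..<m} \<union> {m} \<union> (\<lambda>j. m + Suc j) ` {..<m}"
  proof (intro equalityI subsetI)
    fix x assume "x \<in> {..<p}"
    then show "x \<in> {..<m} \<union> {m} \<union> (\<lambda>j. m + Suc j) ` {..<m}"
      using p_eq by (cases "x \<le> m") (auto intro!: image_eqI[of _ _ "x - Suc m"])
  qed (use p_eq in auto)
  then have "(\<Sum>n<p. wzF n m) = (\<Sum>n<m. wzF n m) + wzF m m + (\<Sum>j<m. wzF (m + Suc j) m)"
    by (simp add: sum.union_disjoint sum.reindex inj_on_def disjoint_iff image_iff)
  also have "(\<Sum>n<m. wzF n m) = 0" by (simp add: wzF_def binomial_eq_0)
  finally have "(\<Sum>n<p. wzF n m) = wzF m m + (\<Sum>j<m. wzF (m + Suc j) m)" by simp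
  also have "zcong 4 \<dots> (3 * P * (-1) ^ m + (\<Sum>j<m. P ^ 3 * (K * harm_term j)))"
    unfolding K_def by (intro zcong_add zcong_sum wzF_diagonal wzF_above) simp
  also have "(\<Sum>j<m. P ^ 3 * (K * harm_term j)) = P ^ 3 * (K * (\<Sum>j<m. harm_term j))"
    by (simp add: sum_distrib_left)
  also have "zcong 4 (3 * P * (-1) ^ m + P ^ 3 * (K * (\<Sum>j<m. harm_term j))) (3 * P * (-1) ^ m + P ^ 3 * (K * 0))"
    using zcong_scale[of 1 3 "K * (\<Sum>j<m. harm_term j)" "K * 0"]
    by (intro zcong_add zcong_refl) (use zcong_mult_left[OF harm_term_sum K] in simp)
  finally show ?thesis by simp
qed

section \<open>The terms G(p,k)\<close>

lemma p_odd: "odd p" by (subst p_eq) simp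

text \<open>The base 1/2 = p/2 - m is -m modulo p.\<close>

lemma poch_half_m: "zcong 1 (pochhammer (1 / 2) m) ((-1) ^ m * fact m)"
proof -
  have "zcong 1 (pochhammer (P / 2 + - of_nat m) m) (pochhammer (- of_nat m) m)"
    by (intro zcong_pochhammer zcong_P_half) simp
  also have "P / 2 + - of_nat m = 1 / 2" by (simp add: P_eq field_simps)
  finally show ?thesis unfolding pochhammer_same .
qed

text \<open>Wilson's theorem, with each p - i in (p-1)! = m! \<Prod> (p-i) replaced by -i.\<close>

lemma fact_m_square: "zcong 1 ((-1) ^ m * fact m ^ 2) (-1)"
proof -
  have "zcong 1 upper (\<Prod>i=1..m. - of_nat i)"
    unfolding upper_def by (intro zcong_prod zcong_P_diff) simp
  then have "zcong 1 (fact m * upper) (fact m * (\<Prod>i=1..m. - of_nat i))"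
    by (rule zcong_mult_left) simp
  also have "fact m * (\<Prod>i=1..m. - of_nat i) = ((-1) ^ m * fact m ^ 2 :: rat)"
    by (simp add: fact_prod_of_nat prod_uminus power2_eq_square)
  finally have "zcong 1 (fact (2 * m)) ((-1) ^ m * fact m ^ 2)" unfolding fact_upper .
  moreover have "2 * m = p - 1" using p_eq by simp
  ultimately show ?thesis using zcong_wilson by (metis zcong_sym zcong_trans)
qed

text \<open>Such products remain when the one factor divisible by p is taken out of a Pochhammer
  symbol of length p, as in (1/2)_p = p/2 (1/2)_m (p/2+1)_m.\<close>

lemma poch_pair:
  assumes "zcong 1 x (1 / 2)" "zcong 1 y 1" "x \<in> zp" "y \<in> zp"
  shows "zcong 1 (pochhammer x m * pochhammer y m) (-1)"
proof -
  have "zcong 1 (pochhammer x m * pochhammer y m) (pochhammer (1 / 2) m * pochhammer 1 m)"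
    by (intro zcong_mult zcong_pochhammer) (use assms in auto)
  also have "zcong 1 (pochhammer (1 / 2) m * pochhammer 1 m) ((-1) ^ m * fact m * pochhammer 1 m)"
    by (intro zcong_mult poch_half_m zcong_refl) auto
  also have "(-1) ^ m * fact m * pochhammer 1 m = ((-1) ^ m * fact m ^ 2 :: rat)"
    by (simp add: power2_eq_square flip: pochhammer_fact)
  also have "zcong 1 \<dots> (-1)" by (rule fact_m_square)
  finally show ?thesis .
qed

text \<open>Wilson's theorem again: the last i factors of (p-1)! are -i, ..., -1 modulo p.\<close>

lemma inverse_fact_reflect:
  assumes "i < m"
  shows "zcong 1 (1 / fact (p - 1 - i)) (- ((-1) ^ i * fact i))"
proof -
  have i: "p - 1 - i + i = p - 1" "of_nat (p - 1 - i) + 1 = P - of_nat i"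
    using assms p_eq by (simp_all add: of_nat_diff)
  have u: "fact (p - 1 - i) \<in> zp_unit" using p_ge by (intro zp_unit_fact) simp
  have "zcong 1 (pochhammer (P - of_nat i) i) (pochhammer (- of_nat i) i)"
    by (intro zcong_pochhammer zcong_P_diff) simp
  then have "zcong 1 (fact (p - 1 - i) * pochhammer (P - of_nat i) i) (fact (p - 1 - i) * ((-1) ^ i * fact i))"
    unfolding pochhammer_same by (intro zcong_mult_left) auto
  moreover have "fact (p - 1 - i) * pochhammer (P - of_nat i) i = fact (p - 1)"
    using fact_add[of "p - 1 - i" i] unfolding i by simp
  ultimately have "zcong 1 (fact (p - 1 - i) * ((-1) ^ i * fact i)) (-1)"
    using zcong_wilson by (metis zcong_sym zcong_trans)
  from zcong_mult_left[OF zcong_minus[OF this], of "inverse (fact (p - 1 - i))"] u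
  have "zcong 1 (inverse (fact (p - 1 - i)) * - (fact (p - 1 - i) * ((-1) ^ i * fact i))) (inverse (fact (p - 1 - i)))"
    by simp
  also have "inverse (fact (p - 1 - i)) * - (fact (p - 1 - i) * ((-1) ^ i * fact i)) = - ((-1) ^ i * (fact i :: rat))"
    by (simp add: field_simps)
  finally show ?thesis by (simp add: inverse_eq_divide zcong_sym)
qed

lemma sixteen_power: "zcong 1 (16 ^ p) 16"
proof -
  have "\<not> p dvd 16"
  proof
    assume "p dvd 16"
    then have "p dvd 2 ^ 4" by simp
    then have "p dvd 2" using p_prime prime_dvd_power by blast
    then show False using p_ge by (auto dest: dvd_imp_le)
  qed
  from zcong_mult_left[OF zcong_fermat[OF this], of 16]
  have "zcong 1 (16 * 16 ^ (p - 1)) 16" by simp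
  moreover have "(16 :: rat) * 16 ^ (p - 1) = 16 ^ p" using p_ge by (simp flip: power_Suc)
  ultimately show ?thesis by simp
qed

text \<open>Count of p: two from n^2, one from (1/2)_p, two from (1/2)_{2p+i}, one from the binomial
  coefficient times (i+1)!, minus three from p!^3. The constant is 32 * 1/2 * 1/2 * 3/2 = 12,
  divided by 16^p, which is 16 modulo p.\<close>

lemma wzG_zcong:
  assumes "i < m"
  shows "zcong 4 (wzG p i) (P ^ 3 * (3 / 4 * (fact i / ((1 / 2 + of_nat i) * pochhammer (1 / 2) (Suc i)))))"
proof -
  define A B C D where "A = pochhammer (1 / 2) m * pochhammer (P / 2 + 1) m"
    and "B = pochhammer (P + 1 / 2) m * pochhammer (3 * P / 2 + 1) m"
    and "C = pochhammer (P + 1 / 2 + P) i" and "D = pochhammer (1 / 2 :: rat) (Suc i)"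
  define X where "X = 12 * (-1) ^ i * A ^ 2 * B * C * (1 / fact (p - 1 - i)) / (fact (p - 1) ^ 2 * D ^ 2 * 16 ^ p)"
  have pm: "p = m + Suc m" using p_eq by simp
  have "pochhammer (1 / 2) (m + Suc m) = pochhammer (1 / 2) m * pochhammer (P / 2) (Suc m)"
    unfolding half_plus_m[symmetric] by (rule pochhammer_product')
  then have a: "pochhammer (1 / 2) p = P / 2 * A"
    unfolding A_def pm[symmetric] by (simp add: pochhammer_rec)
  have e: "P + 1 / 2 + of_nat m = 3 * P / 2" by (simp add: P_eq field_simps)
  have "pochhammer (P + 1 / 2) (m + Suc m) = pochhammer (P + 1 / 2) m * pochhammer (3 * P / 2) (Suc m)"
    unfolding e[symmetric] by (rule pochhammer_product')
  then have b: "pochhammer (P + 1 / 2) p = 3 * P / 2 * B"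
    unfolding B_def pm[symmetric] by (simp add: pochhammer_rec)
  have "2 * p + i = p + (p + i)" by simp
  then have c: "pochhammer (1 / 2) (2 * p + i) = P / 2 * A * (3 * P / 2 * B * C)"
    unfolding C_def by (simp only: pochhammer_product' a b[symmetric] add.commute[of "1 / 2" P])
  have pf: "(fact p :: rat) = P * fact (p - 1)" using p_ge by (simp add: fact_reduce)
  have "of_nat (p choose Suc i) = (fact p / (fact (Suc i) * fact (p - Suc i)) :: rat)"
    using assms p_eq by (intro binomial_fact) simp
  then have d: "of_nat (p choose Suc i) * fact (Suc i) = (P * fact (p - 1) * (1 / fact (p - 1 - i)) :: rat)"
    unfolding pf by (simp del: fact_Suc)
  have s: "(-1) ^ (p + Suc i) = ((-1) ^ i :: rat)"
    using p_odd by (simp add: power_add)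
  have D0: "D \<in> zp_unit" "D \<noteq> 0" using poch_half_unit[OF assms] unfolding D_def by auto
  have "wzG p i = 32 * P ^ 2 * (-1) ^ i * (P / 2 * A) * (P / 2 * A * (3 * P / 2 * B * C))
      * (of_nat (p choose Suc i) * fact (Suc i)) / (fact p ^ 3 * D ^ 2 * 16 ^ p)"
    unfolding wzG_def c a s D_def by (simp only: mult.assoc)
  also have "\<dots> = 32 * P ^ 2 * (-1) ^ i * (P / 2 * A) * (P / 2 * A * (3 * P / 2 * B * C))
      * (P * fact (p - 1) * (1 / fact (p - 1 - i))) / ((P * fact (p - 1)) ^ 3 * D ^ 2 * 16 ^ p)"
    unfolding d pf ..
  also have "\<dots> = P ^ 3 * X"
    unfolding X_def using P_nonzero D0 by (simp add: power2_eq_square power3_eq_cube mult_ac)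
  finally have 1: "wzG p i = P ^ 3 * X" .
  have ABC: "A \<in> zp" "B \<in> zp" "C \<in> zp" by (auto simp: A_def B_def C_def)
  have "zcong 1 X (12 * (-1) ^ i * (-1) ^ 2 * (-1) * pochhammer (1 / 2) i * (- ((-1) ^ i * fact i)) / ((-1) ^ 2 * D ^ 2 * 16))"
    unfolding X_def
  proof (intro zcong_divide zcong_mult zcong_power zcong_refl zcong_wilson sixteen_power inverse_fact_reflect assms)
    show A: "zcong 1 A (-1)" unfolding A_def
      by (intro poch_pair) (use zcong_P_half[of 1] in auto)
    show "zcong 1 B (-1)" unfolding B_def
      by (intro poch_pair) (use zcong_shift[of 1 "1 / 2"] zcong_shift[of "3 / 2" 1] in \<open>auto simp: mult.commute\<close>)
    show "zcong 1 C (pochhammer (1 / 2) i)" unfolding C_def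
      by (intro zcong_pochhammer) (use zcong_shift[of 2 "1 / 2"] in \<open>auto simp: algebra_simps\<close>)
  qed (use D0 p_ge ABC in auto)
  also have "12 * (-1) ^ i * (-1) ^ 2 * (-1) * pochhammer (1 / 2) i * (- ((-1) ^ i * fact i)) / ((-1) ^ 2 * D ^ 2 * 16)
     = 3 / 4 * (pochhammer (1 / 2) i * fact i / D ^ 2)" by simp
  also have "pochhammer (1 / 2) i * fact i / D ^ 2 = fact i / ((1 / 2 + of_nat i) * D)"
    using D0 half_plus_nonzero[of i] unfolding D_def
    by (simp add: pochhammer_rec' power2_eq_square)
  finally have "zcong (1 + 3) (P ^ 3 * X) (P ^ 3 * (3 / 4 * (fact i / ((1 / 2 + of_nat i) * D))))"
    unfolding zcong_scale .
  then show ?thesis unfolding 1 D_def by simp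
qed

text \<open>After i is replaced by m - 1 - i, the factor 1/2 + (m-1-i) = p/2 - (i+1) is -(i+1)
  modulo p, and (1/2)_{m-i} is (1/2)_m divided by (p/2 - i)_i. The result is a term of
  \<open>inverse_binomial_sum\<close>.\<close>

lemma reflected_term:
  assumes "i < m"
  shows "zcong 1 (fact (m - Suc i) / ((1 / 2 + of_nat (m - Suc i)) * pochhammer (1 / 2) (Suc (m - Suc i))))
    ((-1) ^ m * ((-1) ^ Suc i * fact i * fact (m - Suc i) / (of_nat (Suc i) * fact m)))"
proof -
  have i: "Suc (m - Suc i) = m - i" "m - i + i = m" "1 / 2 + of_nat (m - i) = P / 2 + - of_nat i"
    "1 / 2 + of_nat (m - Suc i) = P / 2 + - of_nat (Suc i)"
    using assms by (simp_all add: of_nat_diff P_eq field_simps)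
  define A B where "A = pochhammer (1 / 2 :: rat) (m - i)" and "B = pochhammer (P / 2 + - of_nat i) i"
  have AB: "A * B = pochhammer (1 / 2) m"
    unfolding A_def B_def i(3)[symmetric] pochhammer_product'[symmetric] i(2) ..
  have A: "A \<in> zp_unit" unfolding A_def using poch_half_unit[of "m - Suc i"] assms i(1) by simp
  have B: "zcong 1 B ((-1) ^ i * fact i)"
    unfolding B_def pochhammer_same[symmetric] by (intro zcong_pochhammer zcong_P_half) simp
  have fi: "fact i \<in> zp_unit" "of_nat (Suc i) \<in> zp_unit" using assms p_eq by (auto intro!: zp_unit_fact zp_unit_of_nat_less simp del: of_nat_Suc)
  have "zcong 1 (A * ((-1) ^ i * fact i)) (A * B)" using zcong_sym[OF B] A by (intro zcong_mult_left) auto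
  also have "zcong 1 (A * B) ((-1) ^ m * fact m)" unfolding AB by (rule poch_half_m)
  finally have "zcong 1 (A * ((-1) ^ i * fact i) / ((-1) ^ i * fact i)) ((-1) ^ m * fact m / ((-1) ^ i * fact i))"
    using A fi by (intro zcong_divide zcong_refl) auto
  then have A1: "zcong 1 A ((-1) ^ m * fact m / ((-1) ^ i * fact i))" by simp
  have "zcong 1 (fact (m - Suc i) / ((P / 2 + - of_nat (Suc i)) * A))
    (fact (m - Suc i) / ((- of_nat (Suc i)) * ((-1) ^ m * fact m / ((-1) ^ i * fact i))))"
  proof (intro zcong_divide zcong_refl zcong_mult zcong_P_half A1)
    have "P / 2 + - of_nat (Suc i) \<in> zp_unit"
      using zcong_zp_unit[OF zcong_P_half[of "- of_nat (Suc i)"]] zp_unit_uminus[OF fi(2)] by (simp del: of_nat_Suc)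
    then show "(P / 2 + - of_nat (Suc i)) * A \<in> zp_unit" using A by simp
  qed (use A fi in \<open>auto simp del: of_nat_Suc\<close>)
  also have "fact (m - Suc i) / ((- of_nat (Suc i)) * ((-1) ^ m * fact m / ((-1) ^ i * fact i)))
     = ((-1) ^ m * ((-1) ^ Suc i * fact i * fact (m - Suc i) / (of_nat (Suc i) * fact m)) :: rat)"
  proof -
    have "(f / ((- n) * (s * g / (t * h))) :: rat) = s * ((- t) * h * f / (n * g))"
      if "s = 1 \<or> s = -1" for f n s g t h
      using that by (elim disjE) (simp_all add: mult_ac)
    from this[of "(-1) ^ m" "fact (m - Suc i)" "of_nat (Suc i)" "fact m" "(-1) ^ i" "fact i"]
    show ?thesis by (simp add: minus_one_power_iff del: of_nat_Suc)
  qed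
  finally show ?thesis unfolding A_def i .
qed

text \<open>By Fermat (2j)^(p-3) is 1/(2j)^2 modulo p; the 4 on the left absorbs the resulting
  1/4.\<close>

lemma euler_sum: "zcong 1 (4 * of_int (euler_num (p - 3))) (2 * (-1) ^ m * (\<Sum>j=1..m. (-1) ^ j / of_nat j ^ 2))"
proof -
  define r where "r = p - 3"
  have r: "even r" "r > 0" "r + 2 = p - 1" using p_odd p_ge5 unfolding r_def by auto
  have "zcong 1 (of_int (euler_poly r (int p))) (of_int (euler_num r))"
    by (rule zcong_of_int) (simp add: cong_iff_dvd_diff euler_poly_dvd)
  moreover have "int p = 2 * int m + 1" using p_eq by simp
  ultimately have "zcong 1 (of_int (euler_num r)) (of_int (2 * (-1) ^ m * (\<Sum>j=1..m. (-1) ^ j * (2 * int j) ^ r)))"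
    using euler_poly_odd_arg[OF r(1,2), of m] zcong_sym by metis
  also have "of_int (2 * (-1) ^ m * (\<Sum>j=1..m. (-1) ^ j * (2 * int j) ^ r))
     = (2 * (-1) ^ m * (\<Sum>j=1..m. (-1) ^ j * of_nat (2 * j) ^ r) :: rat)" by simp
  also have "zcong 1 \<dots> (2 * (-1) ^ m * (\<Sum>j=1..m. (-1) ^ j * (1 / of_nat (2 * j) ^ 2)))"
  proof (intro zcong_mult_left zcong_sum)
    fix j assume j: "j \<in> {1..m}"
    then have j2: "0 < 2 * j" "2 * j < p" using p_eq by auto
    define x :: rat where "x = of_nat (2 * j)"
    have "zcong 1 (x ^ (p - 1)) 1"
      unfolding x_def using j2 by (intro zcong_fermat) (auto dest: dvd_imp_le)
    moreover have u: "x ^ 2 \<in> zp_unit" unfolding x_def using zp_unit_of_nat_less[OF j2] by (rule zp_unit_power)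
    ultimately have "zcong 1 (x ^ r * x ^ 2) (1 / x ^ 2 * x ^ 2)"
      using zp_unit_nonzero[OF u] unfolding r(3)[symmetric] power_add by simp
    then have "zcong 1 (x ^ r) (1 / x ^ 2)" using u by (rule zcong_cancel)
    then show "zcong 1 (of_nat (2 * j) ^ r) (1 / of_nat (2 * j) ^ 2)" unfolding x_def .
  qed auto
  finally have "zcong 1 (4 * of_int (euler_num r)) (4 * (2 * (-1) ^ m * (\<Sum>j=1..m. (-1) ^ j * (1 / of_nat (2 * j) ^ 2))))"
    by (intro zcong_mult_left) auto
  also have "4 * (2 * (-1) ^ m * (\<Sum>j=1..m. (-1) ^ j * (1 / of_nat (2 * j) ^ 2)))
     = (2 * (-1) ^ m * (\<Sum>j=1..m. (-1) ^ j / of_nat j ^ 2) :: rat)"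
    by (simp add: power_mult_distrib sum_distrib_left mult_ac)
  finally show ?thesis unfolding r_def .
qed

lemma wzG_sum: "zcong 4 (\<Sum>i<m. wzG p i) (3 * P ^ 3 * of_int (euler_num (p - 3)))"
proof -
  define u :: "nat \<Rightarrow> rat" where "u i = fact i / ((1 / 2 + of_nat i) * pochhammer (1 / 2) (Suc i))" for i
  define e :: rat where "e = (\<Sum>j=1..m. (-1) ^ j / of_nat j ^ 2)"
  \<comment> \<open>Reversing the order of summation makes \<open>reflected_term\<close>
    applicable.\<close>
  have "(\<Sum>i<m. u i) = (\<Sum>i<m. u (m - Suc i))" by (rule sum.nat_diff_reindex[symmetric])
  also have "zcong 1 \<dots> (\<Sum>i<m. (-1) ^ m * ((-1) ^ Suc i * fact i * fact (m - Suc i) / (of_nat (Suc i) * fact m)))"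
    unfolding u_def by (intro zcong_sum reflected_term) simp
  also have "\<dots> = (-1) ^ m * (\<Sum>j=1..m. (1 + 2 * (-1) ^ j) / of_nat j ^ 2)"
    unfolding sum_distrib_left[symmetric] inverse_binomial_sum ..
  also have "(\<Sum>j=1..m. (1 + 2 * (-1) ^ j) / of_nat j ^ 2) = (\<Sum>j=1..m. 1 / of_nat j ^ 2) + 2 * e"
    unfolding e_def by (simp add: add_divide_distrib sum.distrib sum_distrib_left)
  also have "zcong 1 ((-1) ^ m * ((\<Sum>j=1..m. 1 / of_nat j ^ 2) + 2 * e)) ((-1) ^ m * (0 + 2 * e))"
    by (intro zcong_mult_left zcong_add zcong_refl sum_inverse_squares) auto
  also have "(-1) ^ m * (0 + 2 * e) = 2 * (-1) ^ m * e" by simp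
  also have "zcong 1 \<dots> (4 * of_int (euler_num (p - 3)))"
    unfolding e_def by (rule zcong_sym[OF euler_sum])
  finally have "zcong 1 (3 / 4 * (\<Sum>i<m. u i)) (3 / 4 * (4 * of_int (euler_num (p - 3))))"
    by (intro zcong_mult_left) auto
  then have "zcong (1 + 3) (P ^ 3 * (3 / 4 * (\<Sum>i<m. u i))) (P ^ 3 * (3 / 4 * (4 * of_int (euler_num (p - 3)))))"
    unfolding zcong_scale .
  moreover have "P ^ 3 * (3 / 4 * (\<Sum>i<m. u i)) = (\<Sum>i<m. P ^ 3 * (3 / 4 * u i))"
    by (simp only: sum_distrib_left)
  ultimately have *: "zcong 4 (\<Sum>i<m. P ^ 3 * (3 / 4 * u i)) (3 * P ^ 3 * of_int (euler_num (p - 3)))"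
    by (simp add: mult_ac)
  have "zcong 4 (\<Sum>i<m. wzG p i) (\<Sum>i<m. P ^ 3 * (3 / 4 * u i))"
    unfolding u_def by (intro zcong_sum wzG_zcong) simp
  from zcong_trans[OF this *] show ?thesis .
qed

lemma supercongruence:
  "zcong 4 (\<Sum>n<p. wzF n 0) (3 * P * (-1) ^ m + 3 * P ^ 3 * of_int (euler_num (p - 3)))"
  unfolding wz_sum[of p m] by (intro zcong_add wzF_sum wzG_sum)

end

theorem theorem1p2:
  fixes p :: nat
  assumes "prime p" and "odd p"
  shows "rat_cong_pow
           (\<Sum>n = 0..p - 1. (of_nat (20 * n + 3) / (- (2 ^ 10)) ^ n)
               * of_nat (fact (4 * n) div (fact n) ^ 4))
           (3 * of_nat p * (-1) ^ ((p - 1) div 2) + 3 * of_nat p ^ 3 * of_int (euler_num (p - 3)))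
           p 4"
proof -
  have p3: "3 \<le> p" using assms prime_ge_2_nat[of p] by (cases "p = 2") auto
  then interpret odd_prime p using assms(1) by unfold_locales
  have "{0..p - 1} = {..<p}" using p3 by auto
  then have eq: "(\<Sum>n = 0..p - 1. (of_nat (20 * n + 3) / (- (2 ^ 10)) ^ n) * of_nat (fact (4 * n) div (fact n) ^ 4))
      = (\<Sum>n<p. wzF n 0)"
    unfolding summand_eq_wzF by simp
  show ?thesis
  proof (cases "p = 3")
    case True
    \<comment> \<open>The general argument divides by 3, so p = 3 is computed directly: the right
      side is -9 + 81 = 72, and the difference is 3^4 times a fraction with denominator
      2^17.\<close>
    have "(\<Sum>n<3. f n) = f 0 + f 1 + f 2" for f :: "nat \<Rightarrow> rat"
      by (simp add: numeral_3_eq_3 numeral_2_eq_2)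
    then have "(\<Sum>n<3. wzF n 0) = 3 - 23 * 24 / 1024 + 43 * 2520 / 1048576"
      unfolding summand_eq_wzF[symmetric] by (simp add: fact_numeral)
    then have "(\<Sum>n<p. wzF n 0) - (3 * of_nat p * (-1) ^ ((p - 1) div 2) + 3 * of_nat p ^ 3 * of_int (euler_num (p - 3)))
        = of_nat p ^ 4 * (of_int (- 112359) / of_int 131072)"
      using True by (simp add: euler_num.simps)
    moreover have "of_int (- 112359) / of_int 131072 \<in> zp"
      unfolding zp_def using True by (intro CollectI exI[of _ "- 112359"] exI[of _ 131072]) simp
    ultimately show ?thesis unfolding eq by (intro rat_cong_pow_if_zcong) (unfold zcong_def, rule bexI)
  next
    case False
    moreover have "p \<noteq> 4" using assms by auto
    ultimately interpret odd_prime_5 p using p3 by unfold_locales simp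
    show ?thesis unfolding eq using supercongruence unfolding m_def by (rule rat_cong_pow_if_zcong)
  qed
qed

end
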